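(* Let $\mu\in\mathbb{R}$ and $u\in\mathcal{C}(\mathbb{R}^d)\cap L^1(\omega)$. (1) If $\mathbf{I}u+\mu u\le0$ in $\Omega$, $u\ge0$ in $\mathbb{R}^d$ and $u>0$ in $\Omega$, then either $\mu<\Lambda^+$, or $\mu=\Lambda^+$ with $u=t\Psi^+$ for some $t>0$. (2) If $\mathbf{I}u+\mu u\ge0$ in $\Omega$, $u\le0$ in $\mathbb{R}^d$ and $u<0$ in $\Omega$, then either $\mu<\Lambda^-$, or $\mu=\Lambda^-$ with $u=t\Psi^-$ for some $t>0$.
   Context: Fix the dimension $d$, $s\in(0,1)$ and $0<\lambda\le\Lambda$. Let $\mathcal{L}_*$ be the class of all operators $$Lu(x)=\frac12\int_{\mathbb{R}^d}\bigl(u(x+y)+u(x-y)-2u(x)\bigr)\frac{k(y/|y|)}{|y|^{d+2s}}\,dy,$$ where $k\in L^\infty(S^{d-1})$, $\lambda\le k\le\Lambda$ and $k(y)=k(-y)$. Let $\mathcal{L}\subset\mathcal{L}_*$ be a nonempty subclass and $\mathbf{I}u=\sup_{L\in\mathcal{L}}Lu$. $\Omega\subset\mathbb{R}^d$ is a bounded (connected) domain with smooth boundary. $L^1(\omega)$ is the set of functions integrable with respect to the weight $\omega(y)=(1+|y|)^{-d-2s}$. All (in)equalities are in the viscosity sense: $\mathbf{I}u\ge f$ in $\Omega$ means that whenever $x_0\in\Omega$, $N\subset\Omega$ is a neighbourhood of $x_0$, and $\varphi\in\mathcal{C}^2(\bar N)$ satisfies $\varphi(x_0)=u(x_0)$ and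 $\varphi>u$ in $N\setminus\{x_0\}$, the function $v$ equal to $\varphi$ in $N$ and $u$ in $N^c$ satisfies $\mathbf{I}v(x_0)\ge f(x_0)$; $\mathbf{I}u\le f$ is defined symmetrically (touching from below, reversed inequality), and $\mathbf{I}u=f$ means both. Define $$\Lambda^+=\sup\{\mu\in\mathbb{R}:\exists\,\psi\in\mathcal{C}(\mathbb{R}^d)\cap L^1(\omega),\ \psi\ge0,\ \psi>0\text{ in }\Omega,\ \mathbf{I}\psi+\mu\psi\le0\text{ in }\Omega\},$$ $$\Lambda^-=\sup\{\mu\in\mathbb{R}:\exists\,\psi\in\mathcal{C}(\mathbb{R}^d)\cap L^1(\omega),\ \psi\le0,\ \psi<0\text{ in }\Omega,\ \mathbf{I}\psi+\mu\psi\ge0\text{ in }\Omega\}.$$ $\mathcal{C}_0(\Omega)$: continuous functions on $\mathbb{R}^d$ vanishing on $\Omega^c$. $\mathcal{C}^{2s+}(\Omega)$: continuous functions $f$ on $\mathbb{R}^d$ such that for each compact $K\subset\Omega$ there is $\alpha>0$ with $f\in\mathcal{C}^{2s+\alpha}(K)$. $\Psi^+,\Psi^-\in\mathcal{C}^{2s+}(\Omega)\cap\mathcal{C}_0(\Omega)$ denote principal eigenfunctions: $\mathbf{I}\Psi^\pm=-\Lambda^\pm\Psi^\pm$ in $\Omega$, with $\Psi^+>0$ and $\Psi^-<0$ in $\Omega$. *)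

theory Defs
  imports "HOL-Analysis.Analysis"
begin

section \<open>Function spaces\<close>

text \<open>
  \<open>derivs_upto P m U f\<close>: all partial derivatives of \<open>f\<close> of order at most \<open>m\<close> exist on the open
  set \<open>U\<close> and each of them, including \<open>f\<close>, satisfies \<open>P\<close>. The witness \<open>g\<close> is the gradient
  on \<open>U\<close> and is unconstrained elsewhere, so that a property \<open>P\<close> that refers to points outside
  \<open>U\<close> is a property of some extension of the derivative.
\<close>

primrec derivs_upto ::
  "(('a::euclidean_space \<Rightarrow> real) \<Rightarrow> bool) \<Rightarrow> nat \<Rightarrow> 'a set \<Rightarrow> ('a \<Rightarrow> real) \<Rightarrow> bool" where
  "derivs_upto P 0 U f = P f"
| "derivs_upto P (Suc m) U f =
     (P f \<and> (\<exists>g. (\<forall>x\<in>U. GDERIV f x :> g x) \<and> (\<forall>b\<in>Basis. derivs_upto P m U (\<lambda>x. g x \<bullet> b))))"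

definition smooth_on :: "'a::euclidean_space set \<Rightarrow> ('a \<Rightarrow> real) \<Rightarrow> bool" where
  "smooth_on U f \<longleftrightarrow> (\<forall>m. derivs_upto (continuous_on U) m U f)"

text \<open>\<open>C\<^sup>2\<close> up to the boundary: the derivatives extend continuously to the closure of \<open>N\<close>.\<close>

definition C2_closure :: "'a::euclidean_space set \<Rightarrow> ('a \<Rightarrow> real) \<Rightarrow> bool" where
  "C2_closure N f \<longleftrightarrow> derivs_upto (continuous_on (closure N)) 2 N f"

definition holder_on :: "real \<Rightarrow> 'a::euclidean_space set \<Rightarrow> ('a \<Rightarrow> real) \<Rightarrow> bool" where
  "holder_on \<beta> K f \<longleftrightarrow> (\<exists>C. \<forall>x\<in>K. \<forall>y\<in>K. \<bar>f x - f y\<bar> \<le> C * dist x y powr \<beta>)"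

text \<open>
  \<open>C\<^sup>\<gamma>(K)\<close> for \<open>\<gamma> > 0\<close> is \<open>C\<^bsup>m,\<beta>\<^esup>(K)\<close> with \<open>\<gamma> = m + \<beta>\<close> and \<open>0 < \<beta> \<le> 1\<close>. Derivatives are taken in a
  neighbourhood of \<open>K\<close>, since \<open>K\<close> may have empty interior.
\<close>

definition holder_space :: "real \<Rightarrow> 'a::euclidean_space set \<Rightarrow> ('a \<Rightarrow> real) \<Rightarrow> bool" where
  "holder_space \<gamma> K f \<longleftrightarrow>
     (let m = nat (\<lceil>\<gamma>\<rceil> - 1) in
      \<exists>U. open U \<and> K \<subseteq> U \<and>
        derivs_upto (\<lambda>h. continuous_on U h \<and> holder_on (\<gamma> - real m) K h) m U f)"

definition C_2s_plus :: "real \<Rightarrow> 'a::euclidean_space set \<Rightarrow> ('a \<Rightarrow> real) set" where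
  "C_2s_plus s \<Omega> = {f. continuous_on UNIV f \<and>
     (\<forall>K. compact K \<and> K \<subseteq> \<Omega> \<longrightarrow> (\<exists>\<alpha>>0. holder_space (2 * s + \<alpha>) K f))}"

definition C_zero :: "'a::euclidean_space set \<Rightarrow> ('a \<Rightarrow> real) set" where
  "C_zero \<Omega> = {f. continuous_on UNIV f \<and> (\<forall>x. x \<notin> \<Omega> \<longrightarrow> f x = 0)}"

definition L1_weight :: "real \<Rightarrow> ('a::euclidean_space \<Rightarrow> real) set" where
  "L1_weight s = {u. integrable lborel (\<lambda>y. u y * (1 + norm y) powr (- real DIM('a) - 2 * s))}"


section \<open>Domains\<close>

text \<open>
  Near each boundary point, \<open>\<Omega>\<close> is the region on one side of the graph of a smooth function over
  the hyperplane orthogonal to a unit vector \<open>\<nu>\<close>. That function is represented by \<open>\<gamma>\<close>, defined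
  on the whole space and invariant under translations along \<open>\<nu>\<close>.
\<close>

definition smooth_boundary :: "'a::euclidean_space set \<Rightarrow> bool" where
  "smooth_boundary \<Omega> \<longleftrightarrow>
     (\<forall>z\<in>frontier \<Omega>. \<exists>r>0. \<exists>\<nu> \<gamma>. norm \<nu> = 1 \<and> smooth_on UNIV \<gamma> \<and>
        (\<forall>x t. \<gamma> (x + t *\<^sub>R \<nu>) = \<gamma> x) \<and>
        \<Omega> \<inter> ball z r = {x \<in> ball z r. \<gamma> x < x \<bullet> \<nu>})"

definition smooth_bounded_domain :: "'a::euclidean_space set \<Rightarrow> bool" where
  "smooth_bounded_domain \<Omega> \<longleftrightarrow>
     open \<Omega> \<and> connected \<Omega> \<and> \<Omega> \<noteq> {} \<and> bounded \<Omega> \<and> smooth_boundary \<Omega>"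


section \<open>Operators\<close>

definition stable_op ::
  "real \<Rightarrow> ('a::euclidean_space \<Rightarrow> real) \<Rightarrow> ('a \<Rightarrow> real) \<Rightarrow> 'a \<Rightarrow> real" where
  "stable_op s k u x =
     1 / 2 * (\<integral>y. (u (x + y) + u (x - y) - 2 * u x)
                   * (k (y /\<^sub>R norm y) / norm y powr (real DIM('a) + 2 * s)) \<partial>lborel)"

text \<open>
  Elements of \<open>L\<^sup>\<infinity>\<close> of the unit sphere are given by Borel representatives for which the bounds and
  the symmetry hold everywhere; the operator depends only on the class of \<open>k\<close>. Values of \<open>k\<close> off
  the sphere are irrelevant.
\<close>

definition admissible_kernel :: "real \<Rightarrow> real \<Rightarrow> ('a::euclidean_space \<Rightarrow> real) \<Rightarrow> bool" where
  "admissible_kernel lam Lam k \<longleftrightarrow>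
     k \<in> borel_measurable (restrict_space borel (sphere 0 1)) \<and>
     (\<forall>\<theta>\<in>sphere 0 1. lam \<le> k \<theta> \<and> k \<theta> \<le> Lam \<and> k (- \<theta>) = k \<theta>)"

definition L_star :: "real \<Rightarrow> real \<Rightarrow> real \<Rightarrow> (('a::euclidean_space \<Rightarrow> real) \<Rightarrow> 'a \<Rightarrow> real) set" where
  "L_star s lam Lam = stable_op s ` {k. admissible_kernel lam Lam k}"

definition I_op ::
  "(('a::euclidean_space \<Rightarrow> real) \<Rightarrow> 'a \<Rightarrow> real) set \<Rightarrow> ('a \<Rightarrow> real) \<Rightarrow> 'a \<Rightarrow> real" where
  "I_op \<L> u x = (SUP L\<in>\<L>. L u x)"


section \<open>Viscosity inequalities\<close>

text \<open>
  \<open>visc_ge \<L> \<Omega> u f\<close> and \<open>visc_le \<L> \<Omega> u f\<close> state that \<open>I u \<ge> f\<close>, respectively \<open>I u \<le> f\<close>, in \<open>\<Omega>\<close>.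
\<close>

definition visc_ge :: "(('a::euclidean_space \<Rightarrow> real) \<Rightarrow> 'a \<Rightarrow> real) set \<Rightarrow> 'a set \<Rightarrow>
    ('a \<Rightarrow> real) \<Rightarrow> ('a \<Rightarrow> real) \<Rightarrow> bool" where
  "visc_ge \<L> \<Omega> u f \<longleftrightarrow>
     (\<forall>x\<^sub>0\<in>\<Omega>. \<forall>N \<phi>. open N \<and> x\<^sub>0 \<in> N \<and> N \<subseteq> \<Omega> \<and> C2_closure N \<phi> \<and>
        \<phi> x\<^sub>0 = u x\<^sub>0 \<and> (\<forall>x\<in>N - {x\<^sub>0}. \<phi> x > u x) \<longrightarrow>
        I_op \<L> (\<lambda>x. if x \<in> N then \<phi> x else u x) x\<^sub>0 \<ge> f x\<^sub>0)"

definition visc_le :: "(('a::euclidean_space \<Rightarrow> real) \<Rightarrow> 'a \<Rightarrow> real) set \<Rightarrow> 'a set \<Rightarrow>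
    ('a \<Rightarrow> real) \<Rightarrow> ('a \<Rightarrow> real) \<Rightarrow> bool" where
  "visc_le \<L> \<Omega> u f \<longleftrightarrow>
     (\<forall>x\<^sub>0\<in>\<Omega>. \<forall>N \<phi>. open N \<and> x\<^sub>0 \<in> N \<and> N \<subseteq> \<Omega> \<and> C2_closure N \<phi> \<and>
        \<phi> x\<^sub>0 = u x\<^sub>0 \<and> (\<forall>x\<in>N - {x\<^sub>0}. \<phi> x < u x) \<longrightarrow>
        I_op \<L> (\<lambda>x. if x \<in> N then \<phi> x else u x) x\<^sub>0 \<le> f x\<^sub>0)"

definition visc_eq :: "(('a::euclidean_space \<Rightarrow> real) \<Rightarrow> 'a \<Rightarrow> real) set \<Rightarrow> 'a set \<Rightarrow>
    ('a \<Rightarrow> real) \<Rightarrow> ('a \<Rightarrow> real) \<Rightarrow> bool" where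
  "visc_eq \<L> \<Omega> u f \<longleftrightarrow> visc_ge \<L> \<Omega> u f \<and> visc_le \<L> \<Omega> u f"


section \<open>Principal eigenvalues and eigenfunctions\<close>

text \<open>
  \<open>I \<psi> + \<mu> \<psi> \<le> 0\<close> is read as \<open>I \<psi> \<le> f\<close> with \<open>f = - \<mu> \<psi>\<close>. Both sets below contain \<open>0\<close>, by
  \<open>\<psi> = 1\<close> and \<open>\<psi> = -1\<close>.
\<close>

definition Lambda_plus ::
  "real \<Rightarrow> (('a::euclidean_space \<Rightarrow> real) \<Rightarrow> 'a \<Rightarrow> real) set \<Rightarrow> 'a set \<Rightarrow> real" where
  "Lambda_plus s \<L> \<Omega> = Sup {\<mu>. \<exists>\<psi>. continuous_on UNIV \<psi> \<and> \<psi> \<in> L1_weight s \<and>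
     (\<forall>x. \<psi> x \<ge> 0) \<and> (\<forall>x\<in>\<Omega>. \<psi> x > 0) \<and> visc_le \<L> \<Omega> \<psi> (\<lambda>x. - \<mu> * \<psi> x)}"

definition Lambda_minus ::
  "real \<Rightarrow> (('a::euclidean_space \<Rightarrow> real) \<Rightarrow> 'a \<Rightarrow> real) set \<Rightarrow> 'a set \<Rightarrow> real" where
  "Lambda_minus s \<L> \<Omega> = Sup {\<mu>. \<exists>\<psi>. continuous_on UNIV \<psi> \<and> \<psi> \<in> L1_weight s \<and>
     (\<forall>x. \<psi> x \<le> 0) \<and> (\<forall>x\<in>\<Omega>. \<psi> x < 0) \<and> visc_ge \<L> \<Omega> \<psi> (\<lambda>x. - \<mu> * \<psi> x)}"

definition principal_eigenfunction_plus ::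
  "real \<Rightarrow> (('a::euclidean_space \<Rightarrow> real) \<Rightarrow> 'a \<Rightarrow> real) set \<Rightarrow> 'a set \<Rightarrow> ('a \<Rightarrow> real) \<Rightarrow> bool" where
  "principal_eigenfunction_plus s \<L> \<Omega> \<Psi> \<longleftrightarrow>
     \<Psi> \<in> C_2s_plus s \<Omega> \<inter> C_zero \<Omega> \<and> (\<forall>x\<in>\<Omega>. \<Psi> x > 0) \<and>
     visc_eq \<L> \<Omega> \<Psi> (\<lambda>x. - Lambda_plus s \<L> \<Omega> * \<Psi> x)"

definition principal_eigenfunction_minus ::
  "real \<Rightarrow> (('a::euclidean_space \<Rightarrow> real) \<Rightarrow> 'a \<Rightarrow> real) set \<Rightarrow> 'a set \<Rightarrow> ('a \<Rightarrow> real) \<Rightarrow> bool" where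
  "principal_eigenfunction_minus s \<L> \<Omega> \<Psi> \<longleftrightarrow>
     \<Psi> \<in> C_2s_plus s \<Omega> \<inter> C_zero \<Omega> \<and> (\<forall>x\<in>\<Omega>. \<Psi> x < 0) \<and>
     visc_eq \<L> \<Omega> \<Psi> (\<lambda>x. - Lambda_minus s \<L> \<Omega> * \<Psi> x)"

end

theory Submission
  imports Defs
begin

text \<open>
  Let \<open>\<Psi>\<close> be the positive eigenfunction, \<open>\<Lambda>\<close> its eigenvalue, and \<open>u\<close> a supersolution with \<open>\<mu> \<ge> \<Lambda>\<close>;
  the negative case is the same after a change of sign. Since \<open>I\<close> is a supremum of linear
  operators and \<open>u \<ge> 0\<close>, the function \<open>w = t \<Psi> - u\<close> satisfies \<open>I w \<ge> - \<Lambda> w\<close> in \<open>\<Omega>\<close>. Let \<open>t\<^sub>0\<close> be the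
  largest number with \<open>t\<^sub>0 \<Psi> \<le> u\<close>, possibly 0, and let \<open>t\<close> decrease to \<open>t\<^sub>0\<close>. Then \<open>w\<close> has a positive
  maximum \<open>M\<close>, attained in \<open>\<Omega>\<close>, which tends to 0. If \<open>u\<close> exceeds \<open>t\<^sub>0 \<Psi>\<close> at some point \<open>z\<close>
  of the space, the operators see this from the maximum point, however far \<open>z\<close> is: the kernels
  are bounded below, so \<open>I w\<close> is at most a fixed negative constant there. This contradicts
  \<open>I w \<ge> - \<Lambda> M\<close> as \<open>M\<close> tends to 0. Hence \<open>u = t\<^sub>0 \<Psi>\<close>, and then the two equations force \<open>\<mu> = \<Lambda>\<close>.
  Lemma \<open>eigenfunction_rigidity\<close> carries out this argument.

  As \<open>u\<close> is only a viscosity supersolution, the inequality for \<open>I w\<close> is obtained by doubling the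
  variables: \<open>t \<Psi>(x) - u(y) - c \<bar>x - y\<bar>\<^sup>2\<close> is maximised over pairs of points (\<open>doubled_maximum\<close>),
  and there both functions are touched by paraboloids. For an operator of order below 2
  the paraboloids can be confined to arbitrarily small balls, where their contribution is negligible;
  what remains is the pointwise inequality \<open>doubling_inequality\<close>.
\<close>

section \<open>Integrability against the jump density\<close>

definition jump_density :: "real \<Rightarrow> 'a::euclidean_space \<Rightarrow> real" where
  "jump_density s y = 1 / norm y powr (real DIM('a) + 2 * s)"

lemma jump_density_nonneg [simp]: "0 \<le> jump_density s y"
  by (simp add: jump_density_def)

lemma jump_density_measurable [measurable]: "jump_density s \<in> borel_measurable borel"
  unfolding jump_density_def by measurable

lemma ball_borel [measurable]: "ball (a :: 'a::euclidean_space) r \<in> sets borel"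
  by simp

lemma dyadic_scale:
  fixes x :: real
  assumes "1 \<le> x"
  obtains n where "2 ^ n \<le> x" "x \<le> 2 ^ Suc n"
proof -
  obtain m where "x < 2 ^ m"
    using real_arch_pow[of 2 x] by auto
  then have ex: "x \<le> 2 ^ Suc m"
    by (smt (verit) power_increasing_iff le_SucI order_refl power_Suc)
  define n where "n = (LEAST k. x \<le> 2 ^ Suc k)"
  have up: "x \<le> 2 ^ Suc n"
    unfolding n_def using ex by (rule LeastI)
  have "2 ^ n \<le> x"
  proof (cases n)
    case 0
    then show ?thesis using assms by simp
  next
    case (Suc k)
    then have "\<not> x \<le> 2 ^ Suc k"
      using not_less_Least[of k "\<lambda>k. x \<le> 2 ^ Suc k"] n_def by auto
    then show ?thesis using Suc by simp
  qed
  then show ?thesis using up that by blast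
qed

text \<open>
  Cut the space into dyadic shells. Near the origin the shell of radius \<open>2 powr (- n)\<close> contributes a
  multiple of \<open>2 powr ((2 * s - 2) * n)\<close>, because the factor \<open>(norm y)\<^sup>2\<close> beats the singularity;
  far away the shell of radius \<open>2 powr n\<close> contributes a multiple of \<open>2 powr (- 2 * s * n)\<close>. Both
  geometric series converge, which is where \<open>0 < s < 1\<close> is used.
\<close>

lemma levy_measure_integrable:
  assumes s: "0 < s" "s < 1"
  shows "integrable lborel (\<lambda>y::'a::euclidean_space. min 1 ((norm y)\<^sup>2) * jump_density s y)"
proof -
  let ?d = "DIM('a)"
  define \<beta> where "\<beta> = real ?d + 2 * s"
  define b :: real where "b = 2 powr \<beta>"
  define \<omega> where "\<omega> = unit_ball_vol ?d"
  have b: "b > 0" and \<omega>: "\<omega> \<ge> 0" and \<beta>: "\<beta> > 0"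
    using s by (auto simp: b_def \<omega>_def \<beta>_def unit_ball_vol_nonneg add_nonneg_pos)
  have pw: "(2 ^ n) powr \<beta> = b ^ n" for n :: nat
    by (simp add: b_def powr_powr flip: powr_realpow) (simp add: mult.commute)
  have dens: "jump_density s y = (1 / norm y) powr \<beta>" for y :: 'a
    by (simp add: jump_density_def \<beta>_def powr_divide)
  define C where "C n = b * (b / 4) ^ n" for n :: nat
  define C' where "C' n = (1 / b) ^ n" for n :: nat
  have C0: "C n \<ge> 0" "C' n \<ge> 0" for n
    using b by (auto simp: C_def C'_def)
  define T where "T n y = C n * indicator (cball 0 ((1/2) ^ n)) y
      + C' n * indicator (cball 0 (2 ^ Suc n)) y" for n and y :: 'a
  have T_meas: "T n \<in> borel_measurable borel" for n
    unfolding T_def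
    by (intro borel_measurable_add borel_measurable_times borel_measurable_const
        borel_measurable_indicator) auto
  have T0: "T n y \<ge> 0" for n y
    using C0 by (simp add: T_def)
  have shell: "\<exists>n. min 1 ((norm y)\<^sup>2) * jump_density s y \<le> T n y" for y :: 'a
  proof (cases "norm y < 1")
    case True
    show ?thesis
    proof (cases "y = 0")
      case True
      then show ?thesis using T0 by (simp)
    next
      case False
      then have "1 \<le> 1 / norm y" using \<open>norm y < 1\<close> by (simp add: field_simps)
      then obtain n where n: "2 ^ n \<le> 1 / norm y" "1 / norm y \<le> 2 ^ Suc n"
        by (rule dyadic_scale)
      have le: "norm y \<le> (1/2) ^ n"
        using n(1) False by (simp add: field_simps power_divide)
      have "(norm y)\<^sup>2 \<le> ((1/2) ^ n)\<^sup>2"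
        using le by (intro power_mono) auto
      also have "\<dots> = (1/4) ^ n"
        by (simp add: power2_eq_square flip: power_mult_distrib)
      finally have 1: "(norm y)\<^sup>2 \<le> (1/4) ^ n" .
      have 2: "jump_density s y \<le> b ^ Suc n"
        unfolding dens pw[symmetric] using n(2) \<beta> by (intro powr_mono2) auto
      have "min 1 ((norm y)\<^sup>2) * jump_density s y \<le> (1/4) ^ n * b ^ Suc n"
        using 1 2 by (intro mult_mono) auto
      also have "\<dots> = C n"
        by (simp add: C_def power_divide)
      also have "\<dots> \<le> T n y"
        using le C0 by (simp add: T_def)
      finally show ?thesis by blast
    qed
  next
    case False
    then have "1 \<le> norm y" by simp
    then obtain n where n: "2 ^ n \<le> norm y" "norm y \<le> 2 ^ Suc n"
      by (rule dyadic_scale)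
    have "jump_density s y \<le> (1 / 2 ^ n) powr \<beta>"
      unfolding dens using n(1) \<beta> by (intro powr_mono2 frac_le) auto
    also have "\<dots> = C' n"
      by (simp add: powr_divide pw C'_def power_divide)
    finally have "min 1 ((norm y)\<^sup>2) * jump_density s y \<le> C' n"
      by (smt (verit) jump_density_nonneg mult_left_le_one_le min_def zero_le_power2)
    also have "\<dots> \<le> T n y"
      using n C0 by (simp add: T_def)
    finally show ?thesis by blast
  qed
  define q1 q2 where "q1 = b / 4 * (1/2) ^ ?d" and "q2 = 1 / b * 2 ^ ?d"
  have "q1 = 2 powr (2 * s - 2)" "q2 = 2 powr (- 2 * s)"
    by (simp_all add: q1_def q2_def b_def \<beta>_def powr_add powr_diff powr_minus powr_realpow power_divide divide_simps)
  then have q: "\<bar>q1\<bar> < 1" "\<bar>q2\<bar> < 1"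
    using s powr_less_cancel_iff[of 2 _ 0] by (auto)
  define S where "S n = b * \<omega> * q1 ^ n + \<omega> * 2 ^ ?d * q2 ^ n" for n :: nat
  have S0: "S n \<ge> 0" for n
    using b \<omega> by (simp add: S_def q1_def q2_def)
  have intT: "(\<integral>\<^sup>+ y. ennreal (T n y) \<partial>lborel) = ennreal (S n)" for n
  proof -
    have "(\<integral>\<^sup>+ y. ennreal (T n y) \<partial>lborel)
        = (\<integral>\<^sup>+ y. ennreal (C n) * indicator (cball 0 ((1/2) ^ n)) y
            + ennreal (C' n) * indicator (cball 0 (2 ^ Suc n)) (y::'a) \<partial>lborel)"
      by (intro nn_integral_cong) (auto simp: T_def C0 ennreal_plus split: split_indicator)
    also have "\<dots> = ennreal (C n) * ennreal (\<omega> * ((1/2) ^ n) ^ ?d)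
          + ennreal (C' n) * ennreal (\<omega> * (2 ^ Suc n) ^ ?d)"
      by (subst nn_integral_add)
        (auto simp: nn_integral_cmult_indicator emeasure_cball \<omega>_def
          intro!: borel_measurable_times_ennreal borel_measurable_const borel_measurable_indicator)
    also have "\<dots> = ennreal (C n * (\<omega> * ((1/2) ^ n) ^ ?d) + C' n * (\<omega> * (2 ^ Suc n) ^ ?d))"
      using C0 \<omega> by (simp add: ennreal_plus ennreal_mult)
    also have "C n * (\<omega> * ((1/2) ^ n) ^ ?d) + C' n * (\<omega> * (2 ^ Suc n) ^ ?d) = S n"
    proof -
      have flip: "(x ^ n) ^ ?d = (x ^ ?d) ^ n" for x :: real
        by (simp add: mult.commute flip: power_mult)
      have "C n * (\<omega> * ((1/2) ^ n) ^ ?d) = b * \<omega> * q1 ^ n"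
        unfolding C_def q1_def flip power_mult_distrib by simp
      moreover have "C' n * (\<omega> * (2 ^ Suc n) ^ ?d) = \<omega> * 2 ^ ?d * q2 ^ n"
        unfolding C'_def q2_def power_Suc power_mult_distrib flip by simp
      ultimately show ?thesis unfolding S_def by (simp only:)
    qed
    finally show ?thesis .
  qed
  have "summable S"
    unfolding S_def using q by (intro summable_add summable_mult summable_geometric) auto
  show ?thesis
  proof (rule integrableI_bounded)
    show "(\<lambda>y::'a. min 1 ((norm y)\<^sup>2) * jump_density s y) \<in> borel_measurable lborel"
      by measurable
    have "(\<integral>\<^sup>+ y. ennreal (norm (min 1 ((norm (y::'a))\<^sup>2) * jump_density s y)) \<partial>lborel)
        \<le> (\<integral>\<^sup>+ y. (\<Sum>n. ennreal (T n y)) \<partial>lborel)"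
    proof (intro nn_integral_mono)
      fix y :: 'a
      obtain n where n: "min 1 ((norm y)\<^sup>2) * jump_density s y \<le> T n y"
        using shell by blast
      have "ennreal (norm (min 1 ((norm y)\<^sup>2) * jump_density s y)) \<le> ennreal (T n y)"
        using n by (intro ennreal_leI) (simp add: abs_mult)
      also have "\<dots> = (\<Sum>k\<in>{n}. ennreal (T k y))" by simp
      also have "\<dots> \<le> (\<Sum>k. ennreal (T k y))"
        by (intro sum_le_suminf) auto
      finally show "ennreal (norm (min 1 ((norm y)\<^sup>2) * jump_density s y)) \<le> (\<Sum>k. ennreal (T k y))" .
    qed
    also have "\<dots> = (\<Sum>n. ennreal (S n))"
      by (subst nn_integral_suminf) (use T_meas in \<open>auto simp: intT\<close>)
    also have "\<dots> = ennreal (suminf S)"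
      using \<open>summable S\<close> S0 by (intro suminf_ennreal2) auto
    finally show "(\<integral>\<^sup>+ y. ennreal (norm (min 1 ((norm (y::'a))\<^sup>2) * jump_density s y)) \<partial>lborel) < \<infinity>"
      using ennreal_less_top le_less_trans by fastforce
  qed
qed

text \<open>
  Away from the origin, \<open>norm y\<close> and \<open>1 + norm (a + y)\<close> are comparable, so the singular density
  is dominated by the translated weight. The sign \<open>\<epsilon>\<close> covers both \<open>f (a + y)\<close> and \<open>f (a - y)\<close>.
\<close>

lemma L1_weight_shift_integrable:
  fixes f :: "'a::euclidean_space \<Rightarrow> real"
  assumes s: "0 < s" and f: "continuous_on UNIV f" "f \<in> L1_weight s"
    and r: "0 < r" and \<epsilon>: "\<bar>\<epsilon>\<bar> = 1"
  shows "integrable lborel (\<lambda>y. indicator {y. r \<le> norm y} y * f (a + \<epsilon> *\<^sub>R y) * jump_density s y)"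
proof -
  let ?\<beta> = "real DIM('a) + 2 * s"
  let ?w = "\<lambda>y::'a. (1 + norm y) powr - ?\<beta>"
  let ?C = "((1 + norm a) / r + 1) powr ?\<beta>"
  have [measurable]: "f \<in> borel_measurable borel"
    using f(1) by (rule borel_measurable_continuous_onI)
  have "integrable lborel (\<lambda>y. f y * ?w y)"
    using f(2) by (simp add: L1_weight_def)
  moreover have "(lborel :: 'a measure) = distr lborel borel (\<lambda>y. a + \<epsilon> *\<^sub>R y)"
    using \<epsilon> lborel_affine[of \<epsilon> a] by (auto simp: density_1)
  ultimately have "integrable (distr lborel borel (\<lambda>y. a + \<epsilon> *\<^sub>R y)) (\<lambda>y. f y * ?w y)"
    by metis
  then have int: "integrable lborel (\<lambda>y. f (a + \<epsilon> *\<^sub>R y) * ?w (a + \<epsilon> *\<^sub>R y))"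
    by (rule integrable_distr[rotated]) measurable
  show ?thesis
  proof (rule Bochner_Integration.integrable_bound[OF integrable_mult_right[OF int, of ?C]])
    show "AE y in lborel. norm (indicator {y. r \<le> norm y} y * f (a + \<epsilon> *\<^sub>R y) * jump_density s y)
        \<le> norm (?C * (f (a + \<epsilon> *\<^sub>R y) * ?w (a + \<epsilon> *\<^sub>R y)))"
    proof (intro AE_I2)
      fix y :: 'a
      show "norm (indicator {y. r \<le> norm y} y * f (a + \<epsilon> *\<^sub>R y) * jump_density s y)
        \<le> norm (?C * (f (a + \<epsilon> *\<^sub>R y) * ?w (a + \<epsilon> *\<^sub>R y)))"
      proof (cases "r \<le> norm y")
        case True
        then have y: "norm y > 0" using r by linarith
        have "1 + norm (a + \<epsilon> *\<^sub>R y) \<le> 1 + norm a + norm y"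
          using norm_triangle_ineq[of a "\<epsilon> *\<^sub>R y"] \<epsilon> by simp
        also have "\<dots> \<le> (1 + norm a) / r * norm y + norm y"
        proof -
          have "(1 + norm a) * 1 \<le> (1 + norm a) * (norm y / r)"
            using True r by (intro mult_left_mono) auto
          then show ?thesis by simp
        qed
        finally have le: "1 + norm (a + \<epsilon> *\<^sub>R y) \<le> ((1 + norm a) / r + 1) * norm y"
          by (simp add: algebra_simps)
        have "(1 + norm (a + \<epsilon> *\<^sub>R y)) powr ?\<beta> \<le> (((1 + norm a) / r + 1) * norm y) powr ?\<beta>"
          using le s by (intro powr_mono2) auto
        also have "\<dots> = ?C * norm y powr ?\<beta>"
          using r by (simp add: powr_mult)
        finally have "(1 + norm (a + \<epsilon> *\<^sub>R y)) powr ?\<beta> \<le> ?C * norm y powr ?\<beta>" .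
        moreover have "(1 + norm (a + \<epsilon> *\<^sub>R y)) powr ?\<beta> > 0"
          using add_pos_nonneg[of 1 "norm (a + \<epsilon> *\<^sub>R y)"] by simp
        moreover have "norm y powr ?\<beta> > 0" using y by simp
        ultimately have "1 / norm y powr ?\<beta> \<le> ?C / (1 + norm (a + \<epsilon> *\<^sub>R y)) powr ?\<beta>"
          by (subst frac_le_eq) (auto simp: divide_le_0_iff)
        then have "jump_density s y \<le> ?C * ?w (a + \<epsilon> *\<^sub>R y)"
          unfolding jump_density_def powr_minus_divide by simp
        then have "\<bar>f (a + \<epsilon> *\<^sub>R y)\<bar> * jump_density s y \<le> \<bar>f (a + \<epsilon> *\<^sub>R y)\<bar> * (?C * ?w (a + \<epsilon> *\<^sub>R y))"
          by (rule mult_left_mono) simp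
        then show ?thesis
          using True by (simp add: abs_mult mult_ac)
      qed (simp)
    qed
  qed measurable
qed

lemma jump_density_integrable_away:
  assumes s: "0 < s" "s < 1" and r: "0 < r"
  shows "integrable lborel (\<lambda>y::'a::euclidean_space. indicator {y. r \<le> norm y} y * jump_density s y)"
proof (rule Bochner_Integration.integrable_bound)
  show "integrable lborel (\<lambda>y::'a. max 1 (1 / r\<^sup>2) * (min 1 ((norm y)\<^sup>2) * jump_density s y))"
    using levy_measure_integrable[OF s] by (rule integrable_mult_right)
  show "AE y::'a in lborel. norm (indicator {y. r \<le> norm y} y * jump_density s y)
      \<le> norm (max 1 (1 / r\<^sup>2) * (min 1 ((norm y)\<^sup>2) * jump_density s y))"
  proof (intro AE_I2)
    fix y :: 'a
    have "indicator {y. r \<le> norm y} y \<le> max 1 (1 / r\<^sup>2) * min 1 ((norm y)\<^sup>2)"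
    proof (cases "r \<le> norm y")
      case True
      then have "r\<^sup>2 \<le> (norm y)\<^sup>2" using r by (intro power_mono) auto
      then have "1 \<le> 1 / r\<^sup>2 * (norm y)\<^sup>2" using r by (simp add: field_simps)
      moreover have "1 / r\<^sup>2 * (norm y)\<^sup>2 \<le> max 1 (1 / r\<^sup>2) * (norm y)\<^sup>2"
        by (intro mult_right_mono) auto
      ultimately show ?thesis using True by (auto simp: min_def max_def)
    qed auto
    then have "indicator {y. r \<le> norm y} y * jump_density s y
        \<le> max 1 (1 / r\<^sup>2) * min 1 ((norm y)\<^sup>2) * jump_density s y"
      by (rule mult_right_mono) simp
    then show "norm (indicator {y. r \<le> norm y} y * jump_density s y)
      \<le> norm (max 1 (1 / r\<^sup>2) * (min 1 ((norm y)\<^sup>2) * jump_density s y))"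
      by (simp add: abs_mult mult.assoc)
  qed
qed measurable

lemma levy_second_moment_integrable:
  assumes s: "0 < s" "s < 1"
  shows "integrable lborel (\<lambda>y::'a::euclidean_space. indicator (ball 0 r) y * (norm y)\<^sup>2 * jump_density s y)"
proof (rule Bochner_Integration.integrable_bound)
  show "integrable lborel (\<lambda>y::'a. max 1 (r\<^sup>2) * (min 1 ((norm y)\<^sup>2) * jump_density s y))"
    using levy_measure_integrable[OF s] by (rule integrable_mult_right)
  show "AE y::'a in lborel. norm (indicator (ball 0 r) y * (norm y)\<^sup>2 * jump_density s y)
      \<le> norm (max 1 (r\<^sup>2) * (min 1 ((norm y)\<^sup>2) * jump_density s y))"
  proof (intro AE_I2)
    fix y :: 'a
    have "indicator (ball 0 r) y * (norm y)\<^sup>2 \<le> max 1 (r\<^sup>2) * min 1 ((norm y)\<^sup>2)"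
    proof (cases "norm y < r")
      case True
      then have "(norm y)\<^sup>2 \<le> r\<^sup>2" by (intro power_mono) auto
      moreover have "(norm y)\<^sup>2 \<le> max 1 (r\<^sup>2) * (norm y)\<^sup>2"
        using mult_right_mono[of 1 "max 1 (r\<^sup>2)" "(norm y)\<^sup>2"] by simp
      ultimately show ?thesis using True by (auto simp: min_def max_def)
    qed auto
    then have "indicator (ball 0 r) y * (norm y)\<^sup>2 * jump_density s y
        \<le> max 1 (r\<^sup>2) * min 1 ((norm y)\<^sup>2) * jump_density s y"
      by (rule mult_right_mono) simp
    then show "norm (indicator (ball 0 r) y * (norm y)\<^sup>2 * jump_density s y)
      \<le> norm (max 1 (r\<^sup>2) * (min 1 ((norm y)\<^sup>2) * jump_density s y))"
      by (simp add: abs_mult mult.assoc)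
  qed
qed measurable

text \<open>
  The contribution of a fixed paraboloid, restricted to a small ball, to any operator of the
  class vanishes with the radius of the ball.
\<close>

lemma levy_second_moment_tendsto_0:
  assumes s: "0 < s" "s < 1"
  shows "(\<lambda>n. \<integral>y. indicator (ball (0::'a::euclidean_space) (1 / Suc n)) y * (norm y)\<^sup>2 * jump_density s y \<partial>lborel)
    \<longlonglongrightarrow> 0"
proof -
  have "(\<lambda>n. \<integral>y. indicator (ball (0::'a) (1 / Suc n)) y * (norm y)\<^sup>2 * jump_density s y \<partial>lborel)
    \<longlonglongrightarrow> (\<integral>y. 0 \<partial>(lborel :: 'a measure))"
  proof (rule integral_dominated_convergence[where w = "\<lambda>y. indicator (ball 0 1) y * (norm y)\<^sup>2 * jump_density s y"])
    show "integrable lborel (\<lambda>y::'a. indicator (ball 0 1) y * (norm y)\<^sup>2 * jump_density s y)"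
      using s by (rule levy_second_moment_integrable)
    show "AE y::'a in lborel. (\<lambda>n. indicator (ball 0 (1 / Suc n)) y * (norm y)\<^sup>2 * jump_density s y) \<longlonglongrightarrow> 0"
    proof (intro AE_I2)
      fix y :: 'a
      show "(\<lambda>n. indicator (ball 0 (1 / Suc n)) y * (norm y)\<^sup>2 * jump_density s y) \<longlonglongrightarrow> 0"
      proof (cases "y = 0")
        case False
        then have "eventually (\<lambda>n. 1 / Suc n < norm y) sequentially"
          using order_tendstoD(2)[OF LIMSEQ_inverse_real_of_nat, of "norm y"]
          by (simp add: inverse_eq_divide)
        then have "eventually (\<lambda>n. indicator (ball 0 (1 / Suc n)) y * (norm y)\<^sup>2 * jump_density s y = 0) sequentially"
          by eventually_elim (auto split: split_indicator)
        then show ?thesis by (rule tendsto_eventually)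
      qed simp
    qed
    show "AE y::'a in lborel. norm (indicator (ball 0 (1 / Suc n)) y * (norm y)\<^sup>2 * jump_density s y)
      \<le> indicator (ball 0 1) y * (norm y)\<^sup>2 * jump_density s y" for n
    proof (intro AE_I2)
      fix y :: 'a
      have "norm y < 1" if "norm y < 1 / real (Suc n)"
        using that by (rule less_le_trans) simp
      then show "norm (indicator (ball 0 (1 / Suc n)) y * (norm y)\<^sup>2 * jump_density s y)
      \<le> indicator (ball 0 1) y * (norm y)\<^sup>2 * jump_density s y"
        by (auto split: split_indicator)
    qed
  qed measurable
  then show ?thesis by simp
qed

section \<open>Operators on functions that are quadratic near a point\<close>

text \<open>
  The second difference at \<open>a\<close> of a function that agrees with \<open>f\<close> outside \<open>ball a r\<close> and with a
  quadratic polynomial, with value \<open>f a\<close> at \<open>a\<close> and second-order part \<open>q * (norm (x - a))\<^sup>2\<close>, inside.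
  The linear part cancels, so it is not a parameter.
\<close>

definition patched_diff :: "real \<Rightarrow> real \<Rightarrow> ('a::euclidean_space \<Rightarrow> real) \<Rightarrow> 'a \<Rightarrow> 'a \<Rightarrow> real" where
  "patched_diff r q f a y =
     (if norm y < r then 2 * q * (norm y)\<^sup>2 else f (a + y) + f (a - y) - 2 * f a)"

lemma patched_diff_measurable:
  assumes "continuous_on UNIV f"
  shows "patched_diff r q f a \<in> borel_measurable borel"
proof -
  have [measurable]: "f \<in> borel_measurable borel"
    using assms by (rule borel_measurable_continuous_onI)
  show ?thesis
    unfolding patched_diff_def by measurable
qed

lemma patched_diff_integrable:
  fixes f :: "'a::euclidean_space \<Rightarrow> real"
  assumes s: "0 < s" "s < 1" and f: "continuous_on UNIV f" "f \<in> L1_weight s" and r: "0 < r"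
  shows "integrable lborel (\<lambda>y. patched_diff r q f a y * jump_density s y)"
proof -
  have "integrable lborel (\<lambda>y.
      2 * q * (indicator (ball 0 r) y * (norm y)\<^sup>2 * jump_density s y)
      + (indicator {y. r \<le> norm y} y * f (a + 1 *\<^sub>R y) * jump_density s y
         + indicator {y. r \<le> norm y} y * f (a + (-1) *\<^sub>R y) * jump_density s y
         - 2 * f a * (indicator {y. r \<le> norm y} y * jump_density s y)))"
    using s f r
    by (intro Bochner_Integration.integrable_add Bochner_Integration.integrable_diff
        integrable_mult_right levy_second_moment_integrable L1_weight_shift_integrable
        jump_density_integrable_away) auto
  also have "(\<lambda>y.
      2 * q * (indicator (ball 0 r) y * (norm y)\<^sup>2 * jump_density s y)
      + (indicator {y. r \<le> norm y} y * f (a + 1 *\<^sub>R y) * jump_density s y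
         + indicator {y. r \<le> norm y} y * f (a + (-1) *\<^sub>R y) * jump_density s y
         - 2 * f a * (indicator {y. r \<le> norm y} y * jump_density s y)))
     = (\<lambda>y. patched_diff r q f a y * jump_density s y)"
    by (auto simp: patched_diff_def fun_eq_iff algebra_simps)
  finally show ?thesis .
qed

definition kernel_density :: "real \<Rightarrow> ('a::euclidean_space \<Rightarrow> real) \<Rightarrow> 'a \<Rightarrow> real" where
  "kernel_density s k y = k (y /\<^sub>R norm y) * jump_density s y"

lemma kernel_density_bounds:
  fixes y :: "'a::euclidean_space"
  assumes "admissible_kernel lam Lam k"
  shows "lam * jump_density s y \<le> kernel_density s k y"
    and "kernel_density s k y \<le> Lam * jump_density s y"
proof -
  have "lam * jump_density s y \<le> kernel_density s k y \<and> kernel_density s k y \<le> Lam * jump_density s y"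
  proof (cases "y = 0")
    case True
    then show ?thesis by (simp add: kernel_density_def jump_density_def)
  next
    case False
    then have "y /\<^sub>R norm y \<in> sphere 0 1" by simp
    then show ?thesis
      using assms unfolding admissible_kernel_def kernel_density_def
      by (meson jump_density_nonneg mult_right_mono)
  qed
  then show "lam * jump_density s y \<le> kernel_density s k y"
    and "kernel_density s k y \<le> Lam * jump_density s y" by auto
qed

lemma kernel_density_nonneg:
  assumes "admissible_kernel lam Lam k" "0 < lam"
  shows "0 \<le> kernel_density s k y"
  using kernel_density_bounds(1)[OF assms(1), of s y] assms(2)
  by (meson jump_density_nonneg less_imp_le mult_nonneg_nonneg order_trans)

lemma kernel_density_measurable:
  assumes "admissible_kernel lam Lam k"
  shows "kernel_density s k \<in> borel_measurable borel"
proof -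
  have "(\<lambda>y. y /\<^sub>R norm y) \<in> restrict_space borel (- {0::'a}) \<rightarrow>\<^sub>M restrict_space borel (sphere 0 1)"
    by (intro measurable_restrict_space2 measurable_restrict_space1)
      (auto simp: space_restrict_space)
  moreover have "k \<in> borel_measurable (restrict_space borel (sphere 0 1))"
    using assms by (simp add: admissible_kernel_def)
  ultimately have "(\<lambda>y. k (y /\<^sub>R norm y)) \<in> borel_measurable (restrict_space borel (- {0}))"
    by (rule measurable_compose)
  then have [measurable]: "(\<lambda>y. indicator (- {0}) y *\<^sub>R k (y /\<^sub>R norm y)) \<in> borel_measurable borel"
    by (subst (asm) borel_measurable_restrict_space_iff) auto
  have "(\<lambda>y. (indicator (- {0}) y *\<^sub>R k (y /\<^sub>R norm y)) * jump_density s y) \<in> borel_measurable borel"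
    by measurable
  also have "(\<lambda>y. (indicator (- {0}) y *\<^sub>R k (y /\<^sub>R norm y)) * jump_density s y) = kernel_density s k"
    by (auto simp: fun_eq_iff kernel_density_def jump_density_def split: split_indicator)
  finally show ?thesis .
qed

text \<open>
  The bound on the integral is uniform over the kernels; it will show that the supremum defining
  \<open>I_op\<close> is finite.
\<close>

lemma patched_diff_kernel_integrable:
  fixes f :: "'a::euclidean_space \<Rightarrow> real"
  assumes s: "0 < s" "s < 1" and f: "continuous_on UNIV f" "f \<in> L1_weight s" and r: "0 < r"
    and k: "admissible_kernel lam Lam k" and lam: "0 < lam"
  shows "integrable lborel (\<lambda>y. patched_diff r q f a y * kernel_density s k y)"
    and "(\<integral>y. patched_diff r q f a y * kernel_density s k y \<partial>lborel)
      \<le> (\<integral>y. Lam * \<bar>patched_diff r q f a y * jump_density s y\<bar> \<partial>lborel)"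
proof -
  note [measurable] = patched_diff_measurable[OF f(1)] kernel_density_measurable[OF k]
  have dom: "integrable lborel (\<lambda>y. Lam * \<bar>patched_diff r q f a y * jump_density s y\<bar>)"
    using patched_diff_integrable[OF s f r] by (intro integrable_mult_right integrable_abs)
  have le: "\<bar>patched_diff r q f a y * kernel_density s k y\<bar>
      \<le> Lam * \<bar>patched_diff r q f a y * jump_density s y\<bar>" for y
    using mult_left_mono[OF kernel_density_bounds(2)[OF k, of s y], of "\<bar>patched_diff r q f a y\<bar>"]
      kernel_density_nonneg[OF k lam, of s y]
    by (simp add: abs_mult mult_ac)
  show int: "integrable lborel (\<lambda>y. patched_diff r q f a y * kernel_density s k y)"
  proof (rule Bochner_Integration.integrable_bound[OF dom])
    show "AE y in lborel. norm (patched_diff r q f a y * kernel_density s k y)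
      \<le> norm (Lam * \<bar>patched_diff r q f a y * jump_density s y\<bar>)"
      using le by (intro AE_I2) (metis abs_ge_self order_trans real_norm_def)
  qed measurable
  show "(\<integral>y. patched_diff r q f a y * kernel_density s k y \<partial>lborel)
      \<le> (\<integral>y. Lam * \<bar>patched_diff r q f a y * jump_density s y\<bar> \<partial>lborel)"
    using int dom
  proof (rule integral_mono)
    show "patched_diff r q f a y * kernel_density s k y
      \<le> Lam * \<bar>patched_diff r q f a y * jump_density s y\<bar>" for y
      using le[of y] by linarith
  qed
qed

definition quadratic :: "real \<Rightarrow> 'a::euclidean_space \<Rightarrow> real \<Rightarrow> 'a \<Rightarrow> 'a \<Rightarrow> real" where
  "quadratic \<alpha> p q a x = \<alpha> + p \<bullet> (x - a) + q * (norm (x - a))\<^sup>2"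

lemma C2_closure_quadratic: "C2_closure N (quadratic \<alpha> p q a)"
proof -
  have 1: "GDERIV (quadratic \<alpha> p q a) x :> p + (2 * q) *\<^sub>R (x - a)" for x
    unfolding gderiv_def quadratic_def power2_norm_eq_inner
    by (auto intro!: derivative_eq_intros simp: inner_commute algebra_simps)
  have 2: "GDERIV (\<lambda>x. (p + (2 * q) *\<^sub>R (x - a)) \<bullet> b) x :> (2 * q) *\<^sub>R b" for b x
    unfolding gderiv_def
    by (auto intro!: derivative_eq_intros simp: inner_commute algebra_simps)
  have c: "continuous_on A (quadratic \<alpha> p q a)" for A
    unfolding quadratic_def by (intro continuous_intros)
  have "derivs_upto (continuous_on (closure N)) (Suc 0) N (\<lambda>x. (p + (2 * q) *\<^sub>R (x - a)) \<bullet> b)" for b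
    unfolding derivs_upto.simps
    using 2 by (auto intro!: exI[of _ "\<lambda>x. (2 * q) *\<^sub>R b"] continuous_intros)
  then show ?thesis
    unfolding C2_closure_def numeral_2_eq_2 derivs_upto.simps(2)[of _ "Suc 0"]
    using c 1 by (auto simp del: derivs_upto.simps intro!: exI[of _ "\<lambda>x. p + (2 * q) *\<^sub>R (x - a)"])
qed

lemma stable_op_patched_quadratic:
  assumes "0 < r"
  shows "stable_op s k (\<lambda>x. if x \<in> ball a r then quadratic (f a) p q a x else f x) a
    = 1 / 2 * (\<integral>y. patched_diff r q f a y * kernel_density s k y \<partial>lborel)"
proof -
  have "(if a + y \<in> ball a r then quadratic (f a) p q a (a + y) else f (a + y))
      + (if a - y \<in> ball a r then quadratic (f a) p q a (a - y) else f (a - y))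
      - 2 * (if a \<in> ball a r then quadratic (f a) p q a a else f a) = patched_diff r q f a y" for y
    using assms by (auto simp: patched_diff_def quadratic_def dist_norm)
  then show ?thesis
    unfolding stable_op_def by (simp add: kernel_density_def jump_density_def)
qed

section \<open>Viscosity inequalities tested with paraboloids\<close>

text \<open>
  Raising the second-order coefficient by one turns a paraboloid that touches \<open>f\<close> from above
  into one that touches strictly, as an admissible test function must. A supremum that is at
  least \<open>F a\<close> has a member above \<open>F a - \<eta>\<close>, and this provides the kernel.
\<close>

lemma visc_ge_quadratic_test:
  fixes f :: "'a::euclidean_space \<Rightarrow> real"
  assumes \<L>: "\<L> \<subseteq> L_star s lam Lam" "\<L> \<noteq> {}"
    and sub: "visc_ge \<L> \<Omega> f F"
    and r: "0 < r" "ball a r \<subseteq> \<Omega>"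
    and touch: "\<And>x. f x \<le> quadratic (f a) p q a x"
    and \<eta>: "0 < \<eta>"
  obtains k where "admissible_kernel lam Lam k" "stable_op s k \<in> \<L>"
    "F a - \<eta> \<le> 1 / 2 * (\<integral>y. patched_diff r (q + 1) f a y * kernel_density s k y \<partial>lborel)"
proof -
  let ?v = "\<lambda>x. if x \<in> ball a r then quadratic (f a) p (q + 1) a x else f x"
  have "a \<in> ball a r" using r by simp
  moreover have "f x < quadratic (f a) p (q + 1) a x" if "x \<noteq> a" for x
  proof -
    have "0 < (norm (x - a))\<^sup>2" using that by simp
    then show ?thesis
      using touch[of x] unfolding quadratic_def distrib_right left_diff_distrib by linarith
  qed
  moreover have "quadratic (f a) p (q + 1) a a = f a"
    by (simp add: quadratic_def)
  ultimately have I: "F a \<le> I_op \<L> ?v a"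
    using r C2_closure_quadratic
    by (intro sub[unfolded visc_ge_def, rule_format, of a "ball a r"]) auto
  have "\<exists>L\<in>\<L>. F a - \<eta> \<le> L ?v a"
  proof (rule ccontr)
    assume "\<not> ?thesis"
    then have "I_op \<L> ?v a \<le> F a - \<eta>"
      unfolding I_op_def using \<L>(2) by (intro cSUP_least) auto
    then show False using I \<eta> by simp
  qed
  then obtain L where L: "L \<in> \<L>" "F a - \<eta> \<le> L ?v a" by blast
  then obtain k where k: "admissible_kernel lam Lam k" "L = stable_op s k"
    using \<L>(1) unfolding L_star_def by auto
  show ?thesis
    using that[OF k(1)] L unfolding k(2) stable_op_patched_quadratic[OF r(1)] by blast
qed

text \<open>
  The counterpart for touching from below. Here the inequality passes to every kernel
  of the class, in particular to the one that is nearly optimal for a subsolution.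
\<close>

lemma visc_le_quadratic_test:
  fixes g :: "'a::euclidean_space \<Rightarrow> real"
  assumes s: "0 < s" "s < 1" and lam: "0 < lam"
    and \<L>: "\<L> \<subseteq> L_star s lam Lam"
    and g: "continuous_on UNIV g" "g \<in> L1_weight s"
    and super: "visc_le \<L> \<Omega> g G"
    and r: "0 < r" "ball b r \<subseteq> \<Omega>"
    and touch: "\<And>x. quadratic (g b) p q b x \<le> g x"
    and k: "stable_op s k \<in> \<L>"
  shows "1 / 2 * (\<integral>y. patched_diff r (q - 1) g b y * kernel_density s k y \<partial>lborel) \<le> G b"
proof -
  let ?v = "\<lambda>x. if x \<in> ball b r then quadratic (g b) p (q - 1) b x else g x"
  have "b \<in> ball b r" using r by simp
  moreover have "quadratic (g b) p (q - 1) b x < g x" if "x \<noteq> b" for x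
  proof -
    have "0 < (norm (x - b))\<^sup>2" using that by simp
    then show ?thesis
      using touch[of x] unfolding quadratic_def distrib_right left_diff_distrib by linarith
  qed
  moreover have "quadratic (g b) p (q - 1) b b = g b"
    by (simp add: quadratic_def)
  ultimately have I: "I_op \<L> ?v b \<le> G b"
    using r C2_closure_quadratic
    by (intro super[unfolded visc_le_def, rule_format, of b "ball b r"]) auto
  \<comment> \<open>The supremum is taken in the reals, so that it dominates its members only if they are bounded.\<close>
  have "bdd_above ((\<lambda>L. L ?v b) ` \<L>)"
  proof (rule bdd_aboveI2)
    fix L assume "L \<in> \<L>"
    then obtain k' where k': "admissible_kernel lam Lam k'" "L = stable_op s k'"
      using \<L> unfolding L_star_def by auto
    show "L ?v b \<le> 1 / 2 * (\<integral>y. Lam * \<bar>patched_diff r (q - 1) g b y * jump_density s y\<bar> \<partial>lborel)"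
      unfolding k'(2) stable_op_patched_quadratic[OF r(1)]
      using patched_diff_kernel_integrable(2)[OF s g r(1) k'(1) lam] by simp
  qed
  then have "stable_op s k ?v b \<le> I_op \<L> ?v b"
    unfolding I_op_def using k by (intro cSUP_upper)
  then show ?thesis
    using I unfolding stable_op_patched_quadratic[OF r(1)] by simp
qed

section \<open>The doubling inequality\<close>

text \<open>
  With \<open>d\<close> the dimension, half the mass that a kernel bounded below by \<open>lam / norm y powr (d + 2 * s)\<close>
  is sure to give to a ball of radius \<open>\<rho>\<close> lying in \<open>cball 0 R\<close>. It is
  positive and depends neither on the centre of the ball nor on the kernel.
\<close>

definition jump_loss :: "'a::euclidean_space itself \<Rightarrow> real \<Rightarrow> real \<Rightarrow> real \<Rightarrow> real \<Rightarrow> real" where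
  "jump_loss _ s lam R \<rho> =
     lam * (unit_ball_vol (real DIM('a)) * \<rho> ^ DIM('a)) / (2 * R powr (real DIM('a) + 2 * s))"

lemma jump_loss_pos: "0 < lam \<Longrightarrow> 0 < R \<Longrightarrow> 0 < \<rho> \<Longrightarrow> 0 < jump_loss TYPE('a::euclidean_space) s lam R \<rho>"
  by (simp add: jump_loss_def)

text \<open>
  At a maximum \<open>(a, b)\<close> of \<open>\<sigma> * f x - \<tau> * g y - c * (norm (x - y))\<^sup>2\<close>, freezing one of the two variables
  exhibits a paraboloid that touches \<open>f\<close> from above at \<open>a\<close>, respectively \<open>g\<close> from below at \<open>b\<close>.
  Test both inequalities with these paraboloids in balls of radius \<open>r\<close> and subtract, using
  the same kernel. The paraboloids contribute a term that tends to 0 with \<open>r\<close>, for \<open>c\<close> fixed. Moving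
  both variables by the same \<open>y\<close> leaves the penalty unchanged, so that
  \<open>\<sigma> * f (a + y) - \<tau> * g (b + y)\<close> is largest for \<open>y = 0\<close>: the remaining part of the integral is
  nonpositive, and a drop by \<open>m\<close> on a ball of jumps makes it negative by a definite amount.
  Thus functions that are merely continuous are compared as if the second-order
  difference could be evaluated at a common maximum point.
\<close>

lemma doubling_inequality:
  fixes f g :: "'a::euclidean_space \<Rightarrow> real"
  assumes s: "0 < s" "s < 1" and lam: "0 < lam"
    and \<L>: "\<L> \<subseteq> L_star s lam Lam" "\<L> \<noteq> {}"
    and f: "continuous_on UNIV f" "f \<in> L1_weight s" "visc_ge \<L> \<Omega> f F"
    and g: "continuous_on UNIV g" "g \<in> L1_weight s" "visc_le \<L> \<Omega> g G"
    and \<Omega>: "open \<Omega>" "a \<in> \<Omega>" "b \<in> \<Omega>"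
    and \<sigma>: "0 < \<sigma>" and \<tau>: "0 < \<tau>"
    and maximum: "\<And>x y. \<sigma> * f x - \<tau> * g y - c * (norm (x - y))\<^sup>2
      \<le> \<sigma> * f a - \<tau> * g b - c * (norm (a - b))\<^sup>2"
    and \<rho>: "0 < \<rho>" "norm p + \<rho> \<le> R" and m: "0 \<le> m"
    and gap: "\<And>y. y \<in> ball p \<rho> \<Longrightarrow>
      \<rho> \<le> norm y \<and> \<sigma> * f (a + y) - \<tau> * g (b + y) + m \<le> \<sigma> * f a - \<tau> * g b"
  shows "\<sigma> * F a - \<tau> * G b \<le> - (jump_loss TYPE('a) s lam R \<rho> * m)"
proof -
  let ?B = "ball p \<rho>" and ?\<beta> = "real DIM('a) + 2 * s"
  let ?J = "\<lambda>r. \<integral>y. indicator (ball (0::'a) r) y * (norm y)\<^sup>2 * jump_density s y \<partial>lborel"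
  define E where "E = 4 * \<bar>c\<bar> + 2 * \<sigma> + 2 * \<tau>"
  have E: "E \<ge> 0" using \<sigma> \<tau> by (simp add: E_def)
  have "p \<in> ?B" using \<rho> by simp
  then have R: "0 < R" using gap[of p] \<rho> by linarith
  have touch_f: "f x \<le> quadratic (f a) ((2 * c / \<sigma>) *\<^sub>R (a - b)) (c / \<sigma>) a x" for x
  proof -
    have "\<sigma> * f x \<le> \<sigma> * f a + c * ((norm (x - b))\<^sup>2 - (norm (a - b))\<^sup>2)"
      using maximum[of x b] by (simp add: algebra_simps)
    also have "(norm (x - b))\<^sup>2 - (norm (a - b))\<^sup>2 = 2 * ((a - b) \<bullet> (x - a)) + (norm (x - a))\<^sup>2"
      by (simp add: power2_norm_eq_inner inner_diff_left inner_diff_right inner_commute)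
    finally have "f x \<le> (\<sigma> * f a + c * (2 * ((a - b) \<bullet> (x - a)) + (norm (x - a))\<^sup>2)) / \<sigma>"
      using \<sigma> by (simp add: field_simps)
    then show ?thesis
      using \<sigma> by (simp add: quadratic_def add_divide_distrib distrib_left mult.assoc mult.left_commute)
  qed
  have touch_g: "quadratic (g b) ((2 * c / \<tau>) *\<^sub>R (a - b)) (- c / \<tau>) b x \<le> g x" for x
  proof -
    have "\<tau> * g b + c * ((norm (a - b))\<^sup>2 - (norm (a - x))\<^sup>2) \<le> \<tau> * g x"
      using maximum[of a x] by (simp add: algebra_simps)
    also have "(norm (a - b))\<^sup>2 - (norm (a - x))\<^sup>2 = 2 * ((a - b) \<bullet> (x - b)) - (norm (x - b))\<^sup>2"
      by (simp add: power2_norm_eq_inner inner_diff_left inner_diff_right inner_commute)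
    finally have "(\<tau> * g b + c * (2 * ((a - b) \<bullet> (x - b)) - (norm (x - b))\<^sup>2)) / \<tau> \<le> g x"
      using \<tau> by (simp add: field_simps)
    then show ?thesis
      using \<tau> by (simp add: quadratic_def add_divide_distrib diff_divide_distrib right_diff_distrib
          mult.assoc mult.left_commute)
  qed
  have bound: "2 * (\<sigma> * (F a - \<eta>) - \<tau> * G b)
      \<le> E * Lam * ?J r - 2 * (jump_loss TYPE('a) s lam R \<rho> * m)"
    if r: "0 < r" "r \<le> \<rho>" "ball a r \<subseteq> \<Omega>" "ball b r \<subseteq> \<Omega>" and \<eta>: "0 < \<eta>" for r \<eta>
  proof -
    obtain k where k: "admissible_kernel lam Lam k" "stable_op s k \<in> \<L>"
      and kf: "F a - \<eta> \<le> 1 / 2 * (\<integral>y. patched_diff r (c / \<sigma> + 1) f a y * kernel_density s k y \<partial>lborel)"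
      using visc_ge_quadratic_test[OF \<L> f(3) r(1,3) touch_f \<eta>] by blast
    have kg: "1 / 2 * (\<integral>y. patched_diff r (- c / \<tau> - 1) g b y * kernel_density s k y \<partial>lborel) \<le> G b"
      by (rule visc_le_quadratic_test[OF s lam \<L>(1) g r(1,4) touch_g k(2)])
    let ?Df = "patched_diff r (c / \<sigma> + 1) f a" and ?Dg = "patched_diff r (- c / \<tau> - 1) g b"
    let ?K = "kernel_density s k"
    note intf = patched_diff_kernel_integrable(1)[OF s f(1,2) r(1) k(1) lam, of "c / \<sigma> + 1" a]
    note intg = patched_diff_kernel_integrable(1)[OF s g(1,2) r(1) k(1) lam, of "- c / \<tau> - 1" b]
    have shift: "\<sigma> * f (a + y) - \<tau> * g (b + y) \<le> \<sigma> * f a - \<tau> * g b" for y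
      using maximum[of "a + y" "b + y"] by simp
    \<comment> \<open>Since \<open>r \<le> \<rho>\<close>, the ball of jumps on which the drop occurs misses the patched region.\<close>
    have diff: "\<sigma> * ?Df y - \<tau> * ?Dg y \<le> E * (indicator (ball 0 r) y * (norm y)\<^sup>2) - m * indicator ?B y" for y
    proof (cases "norm y < r")
      case True
      then have "y \<notin> ?B" using gap[of y] r by auto
      moreover have "\<sigma> * ?Df y - \<tau> * ?Dg y = (4 * c + 2 * \<sigma> + 2 * \<tau>) * (norm y)\<^sup>2"
        using True \<sigma> \<tau> by (simp add: patched_diff_def field_simps)
      moreover have "\<dots> \<le> E * (norm y)\<^sup>2"
        by (intro mult_right_mono) (auto simp: E_def)
      ultimately show ?thesis using True by simp
    next
      case False
      have "\<sigma> * ?Df y - \<tau> * ?Dg y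
          = (\<sigma> * f (a + y) - \<tau> * g (b + y) - (\<sigma> * f a - \<tau> * g b))
            + (\<sigma> * f (a + - y) - \<tau> * g (b + - y) - (\<sigma> * f a - \<tau> * g b))"
        using False by (simp add: patched_diff_def algebra_simps)
      also have "\<dots> \<le> - (m * indicator ?B y)"
        using gap[of y] shift[of y] shift[of "- y"] by (auto split: split_indicator)
      finally show ?thesis using False by simp
    qed
    have Rdens: "1 / R powr ?\<beta> * indicator ?B y \<le> indicator ?B y * jump_density s y" for y
    proof (cases "y \<in> ?B")
      case True
      then have "0 < norm y" "norm y \<le> R"
        using gap[of y] \<rho> norm_triangle_ineq2[of y p] by (auto simp: dist_norm norm_minus_commute)
      then have "1 / R powr ?\<beta> \<le> jump_density s y"
        unfolding jump_density_def using s R by (intro divide_left_mono powr_mono2) auto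
      then show ?thesis using True by simp
    qed simp
    have pointwise: "\<sigma> * (?Df y * ?K y) - \<tau> * (?Dg y * ?K y)
        \<le> E * Lam * (indicator (ball 0 r) y * (norm y)\<^sup>2 * jump_density s y)
          - m * lam / R powr ?\<beta> * indicator ?B y" for y
    proof -
      have "\<sigma> * (?Df y * ?K y) - \<tau> * (?Dg y * ?K y) = (\<sigma> * ?Df y - \<tau> * ?Dg y) * ?K y"
        by (simp add: algebra_simps)
      also have "\<dots> \<le> (E * (indicator (ball 0 r) y * (norm y)\<^sup>2) - m * indicator ?B y) * ?K y"
        using diff kernel_density_nonneg[OF k(1) lam] by (intro mult_right_mono) auto
      also have "\<dots> = E * (indicator (ball 0 r) y * (norm y)\<^sup>2) * ?K y - m * indicator ?B y * ?K y"
        by (simp add: left_diff_distrib)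
      also have "\<dots> \<le> E * (indicator (ball 0 r) y * (norm y)\<^sup>2) * (Lam * jump_density s y)
          - m * indicator ?B y * (lam * jump_density s y)"
        using kernel_density_bounds[OF k(1), of s y] E m
        by (intro diff_mono mult_left_mono) auto
      also have "m * indicator ?B y * (lam * jump_density s y)
          = m * lam * (indicator ?B y * jump_density s y)" by simp
      also have "E * (indicator (ball 0 r) y * (norm y)\<^sup>2) * (Lam * jump_density s y)
          - m * lam * (indicator ?B y * jump_density s y)
        \<le> E * (indicator (ball 0 r) y * (norm y)\<^sup>2) * (Lam * jump_density s y)
          - m * lam * (1 / R powr ?\<beta> * indicator ?B y)"
        using Rdens[of y] m lam by (intro diff_left_mono mult_left_mono) auto
      finally show ?thesis by (simp add: mult_ac)
    qed
    have intJ: "integrable lborel (\<lambda>y. indicator (ball 0 r) y * (norm y)\<^sup>2 * jump_density s (y::'a))"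
      using s by (rule levy_second_moment_integrable)
    have intB: "integrable lborel (indicat_real ?B)"
      by (simp add: integrable_indicator_iff emeasure_ball less_imp_le[OF \<rho>(1)])
    have "\<sigma> * (\<integral>y. ?Df y * ?K y \<partial>lborel) - \<tau> * (\<integral>y. ?Dg y * ?K y \<partial>lborel)
        = (\<integral>y. \<sigma> * (?Df y * ?K y) - \<tau> * (?Dg y * ?K y) \<partial>lborel)"
      using intf intg by simp
    also have "\<dots> \<le> (\<integral>y. E * Lam * (indicator (ball 0 r) y * (norm y)\<^sup>2 * jump_density s y)
          - m * lam / R powr ?\<beta> * indicator ?B y \<partial>lborel)"
      using intf intg intJ intB pointwise
      by (intro integral_mono Bochner_Integration.integrable_diff integrable_mult_right) auto
    also have "\<dots> = E * Lam * ?J r - m * lam / R powr ?\<beta> * measure lborel ?B"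
      using intJ intB by simp
    also have "m * lam / R powr ?\<beta> * measure lborel ?B = 2 * (jump_loss TYPE('a) s lam R \<rho> * m)"
      using \<rho> by (simp add: jump_loss_def content_ball)
    finally have "\<sigma> * (\<integral>y. ?Df y * ?K y \<partial>lborel) - \<tau> * (\<integral>y. ?Dg y * ?K y \<partial>lborel)
      \<le> E * Lam * ?J r - 2 * (jump_loss TYPE('a) s lam R \<rho> * m)" .
    moreover have "2 * (\<sigma> * (F a - \<eta>)) \<le> \<sigma> * (\<integral>y. ?Df y * ?K y \<partial>lborel)"
      using mult_left_mono[OF kf, of \<sigma>] \<sigma> by simp
    moreover have "\<tau> * (\<integral>y. ?Dg y * ?K y \<partial>lborel) \<le> 2 * (\<tau> * G b)"
      using mult_left_mono[OF kg, of \<tau>] \<tau> by simp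
    ultimately show ?thesis by (simp add: algebra_simps)
  qed
  obtain r1 r2 where r12: "0 < r1" "ball a r1 \<subseteq> \<Omega>" "0 < r2" "ball b r2 \<subseteq> \<Omega>"
    using \<Omega> by (meson open_contains_ball)
  define e where "e = Min {r1, r2, \<rho>}"
  have e: "0 < e" "e \<le> r1" "e \<le> r2" "e \<le> \<rho>"
    using r12 \<rho> by (auto simp: e_def)
  let ?X = "\<lambda>n. 2 * (\<sigma> * (F a - 1 / Suc n) - \<tau> * G b)"
  have inv: "(\<lambda>n. 1 / real (Suc n)) \<longlonglongrightarrow> 0"
    using LIMSEQ_inverse_real_of_nat by (simp add: inverse_eq_divide)
  have "eventually (\<lambda>n. 1 / real (Suc n) < e) sequentially"
    using order_tendstoD(2)[OF inv e(1)] .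
  then have ev: "eventually (\<lambda>n. ?X n
      \<le> E * Lam * ?J (1 / Suc n) - 2 * (jump_loss TYPE('a) s lam R \<rho> * m)) sequentially"
  proof eventually_elim
    case (elim n)
    have "ball a (1 / Suc n) \<subseteq> \<Omega>" "ball b (1 / Suc n) \<subseteq> \<Omega>"
      using r12 e elim subset_ball[of "1 / Suc n" r1 a] subset_ball[of "1 / Suc n" r2 b] by auto
    then show ?case
      using elim e by (intro bound) auto
  qed
  have "?X \<longlonglongrightarrow> 2 * (\<sigma> * (F a - 0) - \<tau> * G b)"
    by (intro tendsto_intros inv)
  moreover have "(\<lambda>n. E * Lam * ?J (1 / Suc n) - 2 * (jump_loss TYPE('a) s lam R \<rho> * m))
      \<longlonglongrightarrow> E * Lam * 0 - 2 * (jump_loss TYPE('a) s lam R \<rho> * m)"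
    by (intro tendsto_intros levy_second_moment_tendsto_0 s)
  ultimately have "2 * (\<sigma> * (F a - 0) - \<tau> * G b)
      \<le> E * Lam * 0 - 2 * (jump_loss TYPE('a) s lam R \<rho> * m)"
    using ev by (intro tendsto_le[OF sequentially_bot]) auto
  then show ?thesis by simp
qed

section \<open>Existence of doubled maxima\<close>

text \<open>
  The penalty forces the two points together: as \<open>Q \<ge> 0\<close> and \<open>P\<close> is bounded with bounded
  support, positive values of the penalised function occur only for \<open>x \<in> \<Omega>\<close> and
  \<open>y\<close> near \<open>x\<close>. This gives attainment and the proximity of \<open>a\<close> and \<open>b\<close> at once, as \<open>c\<close> may be
  taken large; uniform continuity of \<open>P\<close> then compares \<open>P a\<close> with \<open>P b\<close>.
\<close>

lemma doubled_maximum: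
  fixes P Q :: "'a::euclidean_space \<Rightarrow> real"
  assumes P: "continuous_on UNIV P" "\<And>x. 0 \<le> P x" "\<And>x. x \<notin> \<Omega> \<Longrightarrow> P x = 0"
    and Q: "continuous_on UNIV Q" "\<And>x. 0 \<le> Q x"
    and \<Omega>: "bounded \<Omega>" and x0: "Q x0 < P x0" and \<eta>: "0 < \<eta>"
  obtains c a b where "0 < c" "a \<in> \<Omega>" "norm (a - b) < \<eta>" "P a \<le> P b + \<eta>"
    "P x0 - Q x0 \<le> P a - Q b"
    "\<And>x y. P x - Q y - c * (norm (x - y))\<^sup>2 \<le> P a - Q b - c * (norm (a - b))\<^sup>2"
proof -
  obtain R where R: "\<And>x. x \<in> \<Omega> \<Longrightarrow> norm x \<le> R" and "0 < R"
    using \<Omega> bounded_pos by metis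
  let ?D = "cball (0::'a) (R + 1)"
  have "compact (P ` ?D)"
    using P(1) by (intro compact_continuous_image) (auto intro: continuous_on_subset)
  then obtain S0 where S0: "\<And>x. x \<in> ?D \<Longrightarrow> P x \<le> S0"
    using compact_imp_bounded bounded_pos by (metis abs_le_D1 image_eqI real_norm_def)
  define S where "S = max 1 S0"
  have "P x \<le> S" for x
    using S0[of x] R[of x] P(3)[of x] by (cases "x \<in> \<Omega>") (auto simp: S_def)
  moreover have "0 < S" by (simp add: S_def)
  ultimately have S: "\<And>x. P x \<le> S" "0 < S" by auto
  have "uniformly_continuous_on ?D P"
    using P(1) by (intro compact_uniformly_continuous) (auto intro: continuous_on_subset)
  then obtain \<delta> where \<delta>: "0 < \<delta>"
    and uc: "\<And>x y. x \<in> ?D \<Longrightarrow> y \<in> ?D \<Longrightarrow> dist x y < \<delta> \<Longrightarrow> dist (P x) (P y) < \<eta>"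
    unfolding uniformly_continuous_on_def using \<eta> by (metis dist_commute)
  define e where "e = min 1 (min \<delta> \<eta>)"
  have e: "0 < e" "e \<le> 1" "e \<le> \<delta>" "e \<le> \<eta>"
    using \<delta> \<eta> by (auto simp: e_def)
  \<comment> \<open>With this \<open>c\<close>, a pair at distance at least \<open>e\<close> has nonpositive doubled value.\<close>
  define c where "c = S / e\<^sup>2"
  have c: "0 < c" using S e by (simp add: c_def)
  let ?\<Phi> = "\<lambda>x y. P x - Q y - c * (norm (x - y))\<^sup>2"
  have near: "x \<in> \<Omega> \<and> norm (x - y) < e" if "0 < ?\<Phi> x y" for x y
  proof
    have "0 \<le> c * (norm (x - y))\<^sup>2" using c by simp
    then have "P x \<noteq> 0" using that Q(2)[of y] by linarith
    then show "x \<in> \<Omega>" using P(3) by blast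
    have "c * (norm (x - y))\<^sup>2 < c * e\<^sup>2"
      using that Q(2)[of y] S(1)[of x] e by (simp add: c_def)
    then show "norm (x - y) < e"
      using c e power2_less_imp_less[of "norm (x - y)" e] by simp
  qed
  have cont: "continuous_on (?D \<times> ?D) (\<lambda>z. ?\<Phi> (fst z) (snd z))"
    by (intro continuous_intros continuous_on_compose2[OF P(1)] continuous_on_compose2[OF Q(1)]) auto
  have "\<exists>z\<in>?D \<times> ?D. \<forall>w\<in>?D \<times> ?D. ?\<Phi> (fst w) (snd w) \<le> ?\<Phi> (fst z) (snd z)"
    using cont \<open>0 < R\<close> by (intro continuous_attains_sup compact_Times) (auto simp: not_less)
  then obtain z where z: "\<And>w. w \<in> ?D \<times> ?D \<Longrightarrow> ?\<Phi> (fst w) (snd w) \<le> ?\<Phi> (fst z) (snd z)"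
    by blast
  define a b where "a = fst z" and "b = snd z"
  have ab: "?\<Phi> x y \<le> ?\<Phi> a b" if "x \<in> ?D" "y \<in> ?D" for x y
    using z[of "(x, y)"] that by (simp add: a_def b_def)
  have inD: "x \<in> ?D \<and> y \<in> ?D" if "0 < ?\<Phi> x y" for x y
    using near[OF that] R[of x] e norm_triangle_ineq2[of y x]
    by (auto simp: norm_minus_commute)
  have pos0: "0 < ?\<Phi> x0 x0" using x0 by simp
  then have ge: "?\<Phi> x0 x0 \<le> ?\<Phi> a b" using inD ab by blast
  then have pos: "0 < ?\<Phi> a b" using pos0 by linarith
  have maximum: "?\<Phi> x y \<le> ?\<Phi> a b" for x y
    using inD[of x y] ab[of x y] pos by linarith
  show ?thesis
  proof (rule that[OF c])
    show "a \<in> \<Omega>" "norm (a - b) < \<eta>" using near[OF pos] e by auto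
    show "P a \<le> P b + \<eta>"
      using near[OF pos] inD[OF pos] e uc[of a b] by (auto simp: dist_norm abs_less_iff)
    have "0 \<le> c * (norm (a - b))\<^sup>2" using c by simp
    then show "P x0 - Q x0 \<le> P a - Q b" using ge by simp
    show "?\<Phi> x y \<le> ?\<Phi> a b" for x y by (rule maximum)
  qed
qed

section \<open>Rigidity\<close>

text \<open>
  This isolates the argument common to both signs. Here \<open>P\<close> is the absolute value of the
  eigenfunction, \<open>Q\<close> that of the function compared with it, and the hypothesis \<open>comparison\<close> is
  the doubling inequality, with a constant \<open>\<kappa> R \<rho>\<close> independent of \<open>t\<close>. Let \<open>t\<^sub>0\<close> be the
  largest multiple with \<open>t\<^sub>0 * P \<le> Q\<close>, and take \<open>t\<close> slightly larger. The maximum of \<open>t * P - Q\<close> is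
  positive but tends to 0 as \<open>t\<close> decreases to \<open>t\<^sub>0\<close>. If \<open>Q z > t\<^sub>0 * P z\<close> for some \<open>z\<close>, inside or outside
  \<open>\<Omega>\<close>, then jumps from the maximum point to the vicinity of \<open>z\<close> cost a fixed amount, while
  the zeroth-order terms allow at most \<open>\<bar>\<Lambda>\<bar>\<close> times the small maximum. Hence \<open>Q = t\<^sub>0 * P\<close>.
  The case \<open>t\<^sub>0 = 0\<close> is included: that \<open>t\<^sub>0 > 0\<close> follows afterwards, from \<open>Q > 0\<close> in \<open>\<Omega>\<close>.

  For \<open>\<mu> > \<Lambda>\<close> the function \<open>t\<^sub>0 * P\<close> would be a strict supersolution: the zeroth-order terms have a gain
  \<open>(\<mu> - \<Lambda>) * Q b\<close>, which is bounded below near the maximum of \<open>P\<close>, again against a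
  loss proportional to \<open>t - t\<^sub>0\<close>.
\<close>

lemma eigenfunction_rigidity:
  fixes P Q :: "'a::euclidean_space \<Rightarrow> real" and \<kappa> :: "real \<Rightarrow> real \<Rightarrow> real"
  assumes P: "continuous_on UNIV P" "\<And>x. x \<notin> \<Omega> \<Longrightarrow> P x = 0" "\<And>x. x \<in> \<Omega> \<Longrightarrow> 0 < P x"
    and Q: "continuous_on UNIV Q" "\<And>x. 0 \<le> Q x" "\<And>x. x \<in> \<Omega> \<Longrightarrow> 0 < Q x"
    and \<Omega>: "bounded \<Omega>" "\<Omega> \<noteq> {}"
    and \<mu>: "\<Lambda> \<le> \<mu>"
    and \<kappa>: "\<And>R \<rho>. 0 < R \<Longrightarrow> 0 < \<rho> \<Longrightarrow> 0 < \<kappa> R \<rho>"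
    and comparison: "\<And>t c a b p \<rho> R m. \<lbrakk>0 < t; a \<in> \<Omega>; b \<in> \<Omega>;
        \<And>x y. t * P x - Q y - c * (norm (x - y))\<^sup>2 \<le> t * P a - Q b - c * (norm (a - b))\<^sup>2;
        0 < \<rho>; norm p + \<rho> \<le> R; 0 \<le> m;
        \<And>y. y \<in> ball p \<rho> \<Longrightarrow> \<rho> \<le> norm y \<and> t * P (a + y) - Q (b + y) + m \<le> t * P a - Q b\<rbrakk>
      \<Longrightarrow> \<mu> * Q b - \<Lambda> * (t * P a) \<le> - (\<kappa> R \<rho> * m)"
  shows "\<mu> = \<Lambda> \<and> (\<exists>t>0. \<forall>x. Q x = t * P x)"
proof -
  have P0: "0 \<le> P x" for x
    using P(2,3)[of x] by (cases "x \<in> \<Omega>") (auto intro: less_imp_le)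
  obtain x\<^sub>0 where "x\<^sub>0 \<in> \<Omega>" using \<Omega>(2) by blast
  obtain R\<^sub>0 where R\<^sub>0: "\<And>x. x \<in> \<Omega> \<Longrightarrow> norm x \<le> R\<^sub>0" "0 < R\<^sub>0"
    using \<Omega>(1) bounded_pos by metis
  have "\<exists>x\<in>cball 0 R\<^sub>0. \<forall>y\<in>cball 0 R\<^sub>0. P y \<le> P x"
    using P(1) R\<^sub>0 by (intro continuous_attains_sup) (auto intro: continuous_on_subset simp: not_less)
  then obtain x1 where "\<And>y. y \<in> cball 0 R\<^sub>0 \<Longrightarrow> P y \<le> P x1" by blast
  then have x1: "P y \<le> P x1" for y
    using R\<^sub>0(1)[of y] P(2)[of y] P0[of x1] by (cases "y \<in> \<Omega>") auto
  have S: "0 < P x1"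
    using x1[of x\<^sub>0] P(3)[OF \<open>x\<^sub>0 \<in> \<Omega>\<close>] by linarith
  \<comment> \<open>The largest multiple of \<open>P\<close> below \<open>Q\<close>.\<close>
  define t\<^sub>0 where "t\<^sub>0 = (INF x\<in>\<Omega>. Q x / P x)"
  have bdd: "bdd_below ((\<lambda>x. Q x / P x) ` \<Omega>)"
    using Q(2) P0 by (intro bdd_belowI2[of _ 0]) auto
  have t\<^sub>0: "0 \<le> t\<^sub>0"
    unfolding t\<^sub>0_def using Q(2) P0 \<Omega>(2) by (intro cINF_greatest) auto
  have below: "t\<^sub>0 * P x \<le> Q x" for x
  proof (cases "x \<in> \<Omega>")
    case True
    then have "t\<^sub>0 \<le> Q x / P x"
      unfolding t\<^sub>0_def using bdd by (intro cINF_lower)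
    then show ?thesis using P(3)[OF True] by (simp add: field_simps)
  next
    case False
    then show ?thesis using P(2) Q(2) by simp
  qed
  have doubling: "\<exists>c a b. a \<in> \<Omega> \<and> b \<in> \<Omega> \<and> norm (a - b) < \<eta> \<and> t * P a \<le> t * P b + \<eta>
      \<and> t * P x - Q x \<le> t * P a - Q b \<and> 0 < t * P a - Q b
      \<and> t * P a - Q b \<le> (t - t\<^sub>0) * P x1 + \<eta>
      \<and> (\<forall>x y. t * P x - Q y - c * (norm (x - y))\<^sup>2 \<le> t * P a - Q b - c * (norm (a - b))\<^sup>2)"
    if t: "t\<^sub>0 < t" and \<eta>: "0 < \<eta>" "\<eta> < t * P x - Q x" for t \<eta> x
  proof -
    have pos: "Q x < t * P x" using \<eta> by linarith
    have nonneg: "0 \<le> t * P y" for y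
      using t t\<^sub>0 P0 by simp
    have zero: "t * P y = 0" if "y \<notin> \<Omega>" for y
      using P(2)[OF that] by simp
    have cont: "continuous_on UNIV (\<lambda>y. t * P y)"
      using P(1) by (intro continuous_intros)
    obtain c a b where cab: "0 < c" "a \<in> \<Omega>" "norm (a - b) < \<eta>" "t * P a \<le> t * P b + \<eta>"
        "t * P x - Q x \<le> t * P a - Q b"
        "\<And>x y. t * P x - Q y - c * (norm (x - y))\<^sup>2 \<le> t * P a - Q b - c * (norm (a - b))\<^sup>2"
      using doubled_maximum[of "\<lambda>y. t * P y", OF cont nonneg zero Q(1,2) \<Omega>(1) pos \<eta>(1)] by blast
    have "0 < t * P b" using cab(4,5) \<eta> Q(2)[of b] by linarith
    then have "b \<in> \<Omega>" using P(2)[of b] by fastforce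
    have "t * P b - Q b \<le> (t - t\<^sub>0) * P b"
      using below[of b] by (simp add: algebra_simps)
    also have "\<dots> \<le> (t - t\<^sub>0) * P x1"
      using x1 t by (intro mult_left_mono) auto
    finally have "t * P a - Q b \<le> (t - t\<^sub>0) * P x1 + \<eta>"
      using cab(4) by linarith
    then show ?thesis using cab \<open>b \<in> \<Omega>\<close> pos by (intro exI[of _ c] exI[of _ a] exI[of _ b]) auto
  qed
  have defect: "\<mu> * Q b - \<Lambda> * (t * P a) \<ge> (\<mu> - \<Lambda>) * Q b - \<bar>\<Lambda>\<bar> * w"
    if "0 < t * P a - Q b" "t * P a - Q b \<le> w" for t a b w
  proof -
    have "\<Lambda> * (t * P a - Q b) \<le> \<bar>\<Lambda>\<bar> * (t * P a - Q b)"
      using that by (intro mult_right_mono) auto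
    also have "\<dots> \<le> \<bar>\<Lambda>\<bar> * w"
      using that by (intro mult_left_mono) auto
    finally show ?thesis by (simp add: algebra_simps)
  qed
  have above: "Q z \<le> t\<^sub>0 * P z" for z
  proof (rule ccontr)
    assume "\<not> ?thesis"
    then have "0 < Q z - t\<^sub>0 * P z" by simp
    define m where "m = (Q z - t\<^sub>0 * P z) / 3"
    have m: "0 < m" "Q z = t\<^sub>0 * P z + 3 * m"
      using \<open>0 < Q z - t\<^sub>0 * P z\<close> by (auto simp: m_def field_simps)
    \<comment> \<open>The excess \<open>3 * m\<close> at \<open>z\<close> pays for the oscillation of \<open>Q\<close> (\<open>m\<close>), that of \<open>t * P\<close> (\<open>m / 2\<close>) and
      the change from \<open>t\<^sub>0\<close> to \<open>t\<close> (\<open>m / 2\<close>), leaving \<open>m\<close>.\<close>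
    define e where "e = m / 2 / (t\<^sub>0 + 1)"
    have e: "0 < e" using m t\<^sub>0 by (simp add: e_def)
    have "continuous (at z) P" "continuous (at z) Q"
      using P(1) Q(1) by (auto simp: continuous_on_eq_continuous_at)
    then have "\<exists>d>0. \<forall>w. dist w z < d \<longrightarrow> dist (P w) (P z) < e"
      "\<exists>d>0. \<forall>w. dist w z < d \<longrightarrow> dist (Q w) (Q z) < m"
      unfolding continuous_at_eps_delta using e m(1) by (auto simp: dist_norm)
    then obtain d1 d2 where d: "0 < d1" "0 < d2"
      "\<And>w. dist w z < d1 \<Longrightarrow> dist (P w) (P z) < e" "\<And>w. dist w z < d2 \<Longrightarrow> dist (Q w) (Q z) < m"
      by blast
    \<comment> \<open>Room for the radius of the ball of jumps, for the distance between \<open>a\<close> and \<open>b\<close>, and for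
      keeping the jumps at distance \<open>\<rho>\<close> from 0.\<close>
    define \<rho> where "\<rho> = min d1 d2 / 3"
    have \<rho>: "0 < \<rho>" "3 * \<rho> \<le> d1" "3 * \<rho> \<le> d2"
      using d by (auto simp: \<rho>_def)
    define R where "R = norm z + R\<^sub>0 + \<rho>"
    have "0 < R" using R\<^sub>0 \<rho> by (simp add: R_def add_nonneg_pos)
    then have \<kappa>m: "0 < \<kappa> R \<rho> * m" using \<kappa> \<rho> m by simp
    \<comment> \<open>Bounds both the maximum of \<open>t * P - Q\<close> and the error of doubling, so that
      \<open>\<bar>\<Lambda>\<bar> * (2 * h)\<close> stays below the loss \<open>\<kappa> R \<rho> * m\<close>.\<close>
    define h where "h = \<kappa> R \<rho> * m / (4 * (\<bar>\<Lambda>\<bar> + 1))"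
    have h: "0 < h" using \<kappa>m by (simp add: h_def add_nonneg_pos)
    define \<delta> where "\<delta> = min 1 (min (m / (2 * P x1)) (h / P x1))"
    have \<delta>: "0 < \<delta>" "\<delta> \<le> 1" "\<delta> \<le> m / (2 * P x1)" "\<delta> \<le> h / P x1"
      using m h S by (auto simp: \<delta>_def)
    define t where "t = t\<^sub>0 + \<delta>"
    have t: "t\<^sub>0 < t" "t \<le> t\<^sub>0 + 1" "(t - t\<^sub>0) * P x1 \<le> m / 2" "(t - t\<^sub>0) * P x1 \<le> h"
      using \<delta> S by (auto simp: t_def pos_le_divide_eq)
    have "\<exists>x\<in>\<Omega>. Q x / P x < t"
      using t(1) cINF_less_iff[OF \<Omega>(2) bdd] unfolding t\<^sub>0_def by blast
    then obtain x where x: "x \<in> \<Omega>" "Q x < t * P x"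
      using P(3) by (auto simp: field_simps)
    define \<eta> where "\<eta> = min (min \<rho> h) ((t * P x - Q x) / 2)"
    have \<eta>: "0 < \<eta>" "\<eta> \<le> \<rho>" "\<eta> \<le> h" "\<eta> < t * P x - Q x"
      using \<rho> h x by (auto simp: \<eta>_def min_less_iff_disj)
    obtain c a b where ab: "a \<in> \<Omega>" "b \<in> \<Omega>" "norm (a - b) < \<eta>" "0 < t * P a - Q b"
      "t * P a - Q b \<le> (t - t\<^sub>0) * P x1 + \<eta>"
      "\<And>x y. t * P x - Q y - c * (norm (x - y))\<^sup>2 \<le> t * P a - Q b - c * (norm (a - b))\<^sup>2"
      using doubling[OF t(1) \<eta>(1,4)] by blast
    have neg: "t * P w - Q w' \<le> - m" if "norm (w - z) < 3 * \<rho>" "norm (w' - z) < 3 * \<rho>" for w w'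
    proof -
      have "P w \<le> P z + e" "Q z - m \<le> Q w'"
        using d(3)[of w] d(4)[of w'] that \<rho> by (auto simp: dist_norm abs_less_iff)
      then have "t * P w - Q w' \<le> t * (P z + e) - (Q z - m)"
        using t t\<^sub>0 by (intro diff_mono mult_left_mono) auto
      also have "\<dots> = (t - t\<^sub>0) * P z + t * e - 2 * m"
        using m(2) by (simp add: algebra_simps)
      also have "(t - t\<^sub>0) * P z \<le> m / 2"
        using mult_left_mono[OF x1[of z], of "t - t\<^sub>0"] t by linarith
      also have "t * e \<le> (t\<^sub>0 + 1) * e"
        using t e by (intro mult_right_mono) auto
      also have "(t\<^sub>0 + 1) * e = m / 2"
      proof -
        have "t\<^sub>0 + 1 \<noteq> 0" using t\<^sub>0 by simp
        then show ?thesis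
          unfolding e_def by (metis nonzero_mult_div_cancel_left times_divide_eq_right)
      qed
      finally show ?thesis by simp
    qed
    have far: "2 * \<rho> \<le> norm (z - a)"
    proof (rule ccontr)
      assume "\<not> ?thesis"
      then have "norm (a - z) < 2 * \<rho>" by (simp add: norm_minus_commute)
      moreover have "norm (b - z) \<le> norm (a - z) + norm (a - b)"
        using norm_triangle_ineq4[of "a - z" "a - b"] by simp
      ultimately show False
        using neg[of a b] ab(3,4) \<eta>(2) m(1) \<rho>(1) by linarith
    qed
    have "\<mu> * Q b - \<Lambda> * (t * P a) \<le> - (\<kappa> R \<rho> * m)"
    proof (rule comparison[where p = "z - a"])
      show "0 < t" using t t\<^sub>0 by linarith
      show "norm (z - a) + \<rho> \<le> R"
        using norm_triangle_ineq4[of z a] R\<^sub>0(1)[OF ab(1)] by (simp add: R_def)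
      fix y assume "y \<in> ball (z - a) \<rho>"
      then have y: "norm (y - (z - a)) < \<rho>" by (simp add: dist_norm norm_minus_commute)
      have 1: "\<rho> \<le> norm y"
        using y far norm_triangle_ineq2[of "z - a" y] by (simp add: norm_minus_commute)
      have "norm (a + y - z) < 3 * \<rho>"
        using y \<rho>(1) by (simp add: algebra_simps)
      moreover have "norm (b + y - z) < 3 * \<rho>"
        using norm_triangle_ineq4[of "y - (z - a)" "a - b"] y ab(3) \<eta>(2) \<rho>(1)
        by (simp add: algebra_simps)
      ultimately show "\<rho> \<le> norm y \<and> t * P (a + y) - Q (b + y) + m \<le> t * P a - Q b"
        using 1 neg[of "a + y" "b + y"] ab(4) by auto
    qed (use ab m \<rho> in auto)
    moreover have "(\<mu> - \<Lambda>) * Q b - \<bar>\<Lambda>\<bar> * (2 * h) \<le> \<mu> * Q b - \<Lambda> * (t * P a)"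
      using ab t(4) \<eta>(3) by (intro defect) auto
    moreover have "0 \<le> (\<mu> - \<Lambda>) * Q b" using \<mu> Q(2) by simp
    moreover have "\<bar>\<Lambda>\<bar> * (2 * h) < \<kappa> R \<rho> * m"
    proof -
      have "\<bar>\<Lambda>\<bar> * (2 * h) \<le> (\<bar>\<Lambda>\<bar> + 1) * (2 * h)" using h by (intro mult_right_mono) auto
      also have "\<dots> = \<kappa> R \<rho> * m / 2"
        by (simp add: h_def field_simps add_nonneg_eq_0_iff)
      finally show ?thesis using \<kappa>m by linarith
    qed
    ultimately show False by linarith
  qed
  have Q_eq: "Q x = t\<^sub>0 * P x" for x
    using below[of x] above[of x] by linarith
  have t\<^sub>0_pos: "0 < t\<^sub>0"
    using Q(3)[OF \<open>x\<^sub>0 \<in> \<Omega>\<close>] P(3)[OF \<open>x\<^sub>0 \<in> \<Omega>\<close>] Q_eq[of x\<^sub>0] by (simp add: zero_less_mult_iff)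
  have "\<mu> = \<Lambda>"
  proof (rule ccontr)
    assume "\<mu> \<noteq> \<Lambda>"
    then have gt: "0 < \<mu> - \<Lambda>" using \<mu> by simp
    \<comment> \<open>Chosen so that \<open>\<bar>\<Lambda>\<bar> * (3 / 2 * \<delta>)\<close> is less than \<open>(\<mu> - \<Lambda>) * t\<^sub>0 / 2\<close>.\<close>
    define \<delta> where "\<delta> = (\<mu> - \<Lambda>) * t\<^sub>0 / (3 * (\<bar>\<Lambda>\<bar> + 1))"
    have \<delta>: "0 < \<delta>" using gt t\<^sub>0_pos by (simp add: \<delta>_def)
    define t where "t = t\<^sub>0 + \<delta>"
    \<comment> \<open>Half of the maximum \<open>\<delta> * P x1\<close> of \<open>t * P - Q\<close>; it keeps \<open>P b\<close> at least half of \<open>P x1\<close>.\<close>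
    define \<eta> where "\<eta> = \<delta> * P x1 / 2"
    have t: "t\<^sub>0 < t" and \<eta>: "0 < \<eta>" "\<eta> < t * P x1 - Q x1"
      using \<delta> S by (auto simp: t_def \<eta>_def Q_eq algebra_simps)
    obtain c a b where ab: "a \<in> \<Omega>" "b \<in> \<Omega>" "t * P a \<le> t * P b + \<eta>"
      "t * P x1 - Q x1 \<le> t * P a - Q b" "0 < t * P a - Q b"
      "t * P a - Q b \<le> (t - t\<^sub>0) * P x1 + \<eta>"
      "\<And>x y. t * P x - Q y - c * (norm (x - y))\<^sup>2 \<le> t * P a - Q b - c * (norm (a - b))\<^sup>2"
      using doubling[OF t \<eta>] by blast
    obtain v :: 'a where v: "norm v = 2" by (metis vector_choose_size zero_le_numeral)
    \<comment> \<open>With drop 0, any ball of jumps away from the origin will do.\<close>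
    have "\<mu> * Q b - \<Lambda> * (t * P a) \<le> - (\<kappa> 3 1 * 0)"
    proof (rule comparison[where p = v])
      show "0 < t" using t t\<^sub>0 by linarith
      fix y assume "y \<in> ball v 1"
      then have "1 \<le> norm y"
        using v norm_triangle_ineq2[of v y] by (simp add: dist_norm)
      then show "1 \<le> norm y \<and> t * P (a + y) - Q (b + y) + 0 \<le> t * P a - Q b"
        using ab(7)[of "a + y" "b + y"] by simp
    qed (use ab v in auto)
    moreover have "(\<mu> - \<Lambda>) * Q b - \<bar>\<Lambda>\<bar> * (3 / 2 * \<delta> * P x1) \<le> \<mu> * Q b - \<Lambda> * (t * P a)"
      using ab by (intro defect) (auto simp: t_def \<eta>_def)
    moreover have "\<bar>\<Lambda>\<bar> * (3 / 2 * \<delta> * P x1) < (\<mu> - \<Lambda>) * Q b"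
    proof -
      have "\<delta> * (P x1 / 2) \<le> \<delta> * P b"
        using ab(3,4) by (simp add: t_def \<eta>_def Q_eq algebra_simps)
      then have "P x1 / 2 \<le> P b" using \<delta> by (simp only: mult_le_cancel_left_pos)
      have "\<bar>\<Lambda>\<bar> * (3 / 2 * \<delta> * P x1) < (\<bar>\<Lambda>\<bar> + 1) * (3 / 2 * \<delta> * P x1)"
        using \<delta> S by (intro mult_strict_right_mono) auto
      also have "\<dots> = ((\<bar>\<Lambda>\<bar> + 1) * (3 * \<delta>)) * (P x1 / 2)" by simp
      also have "(\<bar>\<Lambda>\<bar> + 1) * (3 * \<delta>) = (\<mu> - \<Lambda>) * t\<^sub>0"
        by (simp add: \<delta>_def field_simps add_nonneg_eq_0_iff)
      also have "(\<mu> - \<Lambda>) * t\<^sub>0 * (P x1 / 2) \<le> (\<mu> - \<Lambda>) * t\<^sub>0 * P b"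
        using \<open>P x1 / 2 \<le> P b\<close> gt t\<^sub>0_pos by (intro mult_left_mono) auto
      finally show ?thesis by (simp add: Q_eq mult.assoc)
    qed
    ultimately show False by linarith
  qed
  then show ?thesis using t\<^sub>0_pos Q_eq by blast
qed

section \<open>Supersolutions at or above the principal eigenvalue\<close>

lemma L1_weight_if_vanishes_off_bounded:
  fixes f :: "'a::euclidean_space \<Rightarrow> real"
  assumes f: "continuous_on UNIV f" "\<And>x. x \<notin> \<Omega> \<Longrightarrow> f x = 0" and \<Omega>: "bounded \<Omega>"
  shows "f \<in> L1_weight s"
proof -
  obtain R where R: "\<And>x. x \<in> \<Omega> \<Longrightarrow> norm x \<le> R"
    using \<Omega> bounded_pos by metis
  define w where "w y = (1 + norm y) powr (- real DIM('a) - 2 * s)" for y :: 'a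
  have "1 + norm y \<noteq> 0" for y :: 'a
    using norm_ge_zero[of y] by linarith
  then have "continuous_on (cball 0 R) w"
    unfolding w_def
    by (intro continuous_on_powr[OF continuous_on_add[OF continuous_on_const continuous_on_norm_id]]
        continuous_on_const) simp
  moreover have "continuous_on (cball 0 R) f"
    using f(1) by (rule continuous_on_subset) simp
  ultimately have "continuous_on (cball 0 R) (\<lambda>y. f y * w y)"
    by (simp add: continuous_on_mult)
  then have int: "integrable lborel (\<lambda>y. indicat_real (cball 0 R) y *\<^sub>R (f y * w y))"
    by (rule borel_integrable_compact[OF compact_cball])
  have "(\<lambda>y. indicat_real (cball 0 R) y *\<^sub>R (f y * w y)) = (\<lambda>y. f y * w y)"
  proof
    fix y
    show "indicat_real (cball 0 R) y *\<^sub>R (f y * w y) = f y * w y"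
      using f(2)[of y] R by (cases "y \<in> \<Omega>") auto
  qed
  with int have "integrable lborel (\<lambda>y. f y * w y)" by (simp only:)
  then show ?thesis unfolding L1_weight_def w_def mem_Collect_eq .
qed

theorem theorem1p5:
  fixes s lam Lam \<mu> :: real
    and \<L> :: "(('a::euclidean_space \<Rightarrow> real) \<Rightarrow> 'a \<Rightarrow> real) set"
    and \<Omega> :: "'a set"
    and \<Psi>\<^sub>p \<Psi>\<^sub>m u :: "'a \<Rightarrow> real"
  assumes s: "0 < s" "s < 1"
    and lam: "0 < lam" "lam \<le> Lam"
    and \<L>: "\<L> \<subseteq> L_star s lam Lam" "\<L> \<noteq> {}"
    and \<Omega>: "smooth_bounded_domain \<Omega>"
    and \<Psi>\<^sub>p: "principal_eigenfunction_plus s \<L> \<Omega> \<Psi>\<^sub>p"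
    and \<Psi>\<^sub>m: "principal_eigenfunction_minus s \<L> \<Omega> \<Psi>\<^sub>m"
    and u: "continuous_on UNIV u" "u \<in> L1_weight s"
  shows "(visc_le \<L> \<Omega> u (\<lambda>x. - \<mu> * u x) \<and> (\<forall>x. u x \<ge> 0) \<and> (\<forall>x\<in>\<Omega>. u x > 0) \<longrightarrow>
            \<mu> < Lambda_plus s \<L> \<Omega> \<or>
            (\<mu> = Lambda_plus s \<L> \<Omega> \<and> (\<exists>t>0. \<forall>x. u x = t * \<Psi>\<^sub>p x)))
       \<and> (visc_ge \<L> \<Omega> u (\<lambda>x. - \<mu> * u x) \<and> (\<forall>x. u x \<le> 0) \<and> (\<forall>x\<in>\<Omega>. u x < 0) \<longrightarrow>
            \<mu> < Lambda_minus s \<L> \<Omega> \<or>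
            (\<mu> = Lambda_minus s \<L> \<Omega> \<and> (\<exists>t>0. \<forall>x. u x = t * \<Psi>\<^sub>m x)))"
proof (intro conjI impI)
  let ?\<kappa> = "jump_loss TYPE('a) s lam"
  have dom: "open \<Omega>" "bounded \<Omega>" "\<Omega> \<noteq> {}"
    using \<Omega> by (auto simp: smooth_bounded_domain_def)
  {
    let ?\<Lambda> = "Lambda_plus s \<L> \<Omega>"
    assume "visc_le \<L> \<Omega> u (\<lambda>x. - \<mu> * u x) \<and> (\<forall>x. u x \<ge> 0) \<and> (\<forall>x\<in>\<Omega>. u x > 0)"
    then have super: "visc_le \<L> \<Omega> u (\<lambda>x. - \<mu> * u x)"
      and nonneg: "\<And>x. 0 \<le> u x" and pos: "\<And>x. x \<in> \<Omega> \<Longrightarrow> 0 < u x" by auto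
    have \<Psi>: "continuous_on UNIV \<Psi>\<^sub>p" "\<And>x. x \<notin> \<Omega> \<Longrightarrow> \<Psi>\<^sub>p x = 0" "\<And>x. x \<in> \<Omega> \<Longrightarrow> 0 < \<Psi>\<^sub>p x"
      and sub: "visc_ge \<L> \<Omega> \<Psi>\<^sub>p (\<lambda>x. - ?\<Lambda> * \<Psi>\<^sub>p x)"
      using \<Psi>\<^sub>p by (auto simp: principal_eigenfunction_plus_def C_zero_def visc_eq_def)
    have \<Psi>_L1: "\<Psi>\<^sub>p \<in> L1_weight s"
      using \<Psi>(1,2) dom(2) by (rule L1_weight_if_vanishes_off_bounded)
    have "\<mu> = ?\<Lambda> \<and> (\<exists>t>0. \<forall>x. u x = t * \<Psi>\<^sub>p x)" if le: "?\<Lambda> \<le> \<mu>"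
    proof (rule eigenfunction_rigidity[OF \<Psi> u(1) nonneg pos dom(2,3) le jump_loss_pos[OF lam(1)]])
      fix t c a b p \<rho> R m
      assume t: "0 < t" "a \<in> \<Omega>" "b \<in> \<Omega>" "0 < \<rho>" "norm p + \<rho> \<le> R" "0 \<le> m"
        and mx: "\<And>x y. t * \<Psi>\<^sub>p x - u y - c * (norm (x - y))\<^sup>2 \<le> t * \<Psi>\<^sub>p a - u b - c * (norm (a - b))\<^sup>2"
        and gap: "\<And>y. y \<in> ball p \<rho> \<Longrightarrow> \<rho> \<le> norm y \<and> t * \<Psi>\<^sub>p (a + y) - u (b + y) + m \<le> t * \<Psi>\<^sub>p a - u b"
      have mx': "t * \<Psi>\<^sub>p x - 1 * u y - c * (norm (x - y))\<^sup>2
          \<le> t * \<Psi>\<^sub>p a - 1 * u b - c * (norm (a - b))\<^sup>2" for x y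
        using mx[of x y] by simp
      have gap': "\<rho> \<le> norm y \<and> t * \<Psi>\<^sub>p (a + y) - 1 * u (b + y) + m \<le> t * \<Psi>\<^sub>p a - 1 * u b"
        if "y \<in> ball p \<rho>" for y
        using gap[OF that] by simp
      have "t * (- ?\<Lambda> * \<Psi>\<^sub>p a) - 1 * (- \<mu> * u b) \<le> - (?\<kappa> R \<rho> * m)"
        by (rule doubling_inequality[OF s lam(1) \<L> \<Psi>(1) \<Psi>_L1 sub u super dom(1) t(2,3,1)
              zero_less_one mx' t(4-6) gap'])
      then show "\<mu> * u b - ?\<Lambda> * (t * \<Psi>\<^sub>p a) \<le> - (?\<kappa> R \<rho> * m)"
        by (simp add: algebra_simps)
    qed
    then show "\<mu> < ?\<Lambda> \<or> (\<mu> = ?\<Lambda> \<and> (\<exists>t>0. \<forall>x. u x = t * \<Psi>\<^sub>p x))"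
      by (cases "\<mu> < ?\<Lambda>") auto
  next
    let ?\<Lambda> = "Lambda_minus s \<L> \<Omega>"
    assume "visc_ge \<L> \<Omega> u (\<lambda>x. - \<mu> * u x) \<and> (\<forall>x. u x \<le> 0) \<and> (\<forall>x\<in>\<Omega>. u x < 0)"
    then have sub: "visc_ge \<L> \<Omega> u (\<lambda>x. - \<mu> * u x)"
      and nonneg: "\<And>x. 0 \<le> - u x" and pos: "\<And>x. x \<in> \<Omega> \<Longrightarrow> 0 < - u x" by auto
    have \<Psi>: "continuous_on UNIV \<Psi>\<^sub>m" "\<And>x. x \<notin> \<Omega> \<Longrightarrow> \<Psi>\<^sub>m x = 0" "\<And>x. x \<in> \<Omega> \<Longrightarrow> \<Psi>\<^sub>m x < 0"
      and super: "visc_le \<L> \<Omega> \<Psi>\<^sub>m (\<lambda>x. - ?\<Lambda> * \<Psi>\<^sub>m x)"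
      using \<Psi>\<^sub>m by (auto simp: principal_eigenfunction_minus_def C_zero_def visc_eq_def)
    have neg_\<Psi>: "continuous_on UNIV (\<lambda>x. - \<Psi>\<^sub>m x)" "\<And>x. x \<notin> \<Omega> \<Longrightarrow> - \<Psi>\<^sub>m x = 0"
      "\<And>x. x \<in> \<Omega> \<Longrightarrow> 0 < - \<Psi>\<^sub>m x"
      using \<Psi> by (auto intro: continuous_intros)
    have neg_u: "continuous_on UNIV (\<lambda>x. - u x)"
      using u(1) by (intro continuous_intros)
    have \<Psi>_L1: "\<Psi>\<^sub>m \<in> L1_weight s"
      using \<Psi>(1,2) dom(2) by (rule L1_weight_if_vanishes_off_bounded)
    \<comment> \<open>Both functions change sign, which exchanges the roles: now \<open>u\<close>, taken at the second of the
      doubled points, is the subsolution, and the eigenfunction is the supersolution.\<close>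
    have "\<mu> = ?\<Lambda> \<and> (\<exists>t>0. \<forall>x. - u x = t * - \<Psi>\<^sub>m x)" if le: "?\<Lambda> \<le> \<mu>"
    proof (rule eigenfunction_rigidity[OF neg_\<Psi> neg_u nonneg pos dom(2,3) le jump_loss_pos[OF lam(1)]])
      fix t c a b p \<rho> R m
      assume t: "0 < t" "a \<in> \<Omega>" "b \<in> \<Omega>" "0 < \<rho>" "norm p + \<rho> \<le> R" "0 \<le> m"
        and mx: "\<And>x y. t * - \<Psi>\<^sub>m x - - u y - c * (norm (x - y))\<^sup>2
          \<le> t * - \<Psi>\<^sub>m a - - u b - c * (norm (a - b))\<^sup>2"
        and gap: "\<And>y. y \<in> ball p \<rho> \<Longrightarrow>
          \<rho> \<le> norm y \<and> t * - \<Psi>\<^sub>m (a + y) - - u (b + y) + m \<le> t * - \<Psi>\<^sub>m a - - u b"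
      have mx': "1 * u x - t * \<Psi>\<^sub>m y - c * (norm (x - y))\<^sup>2
          \<le> 1 * u b - t * \<Psi>\<^sub>m a - c * (norm (b - a))\<^sup>2" for x y
        using mx[of y x] by (simp add: norm_minus_commute)
      have gap': "\<rho> \<le> norm y \<and> 1 * u (b + y) - t * \<Psi>\<^sub>m (a + y) + m \<le> 1 * u b - t * \<Psi>\<^sub>m a"
        if "y \<in> ball p \<rho>" for y
        using gap[OF that] by simp
      have "1 * (- \<mu> * u b) - t * (- ?\<Lambda> * \<Psi>\<^sub>m a) \<le> - (?\<kappa> R \<rho> * m)"
        by (rule doubling_inequality[OF s lam(1) \<L> u sub \<Psi>(1) \<Psi>_L1 super dom(1) t(3,2)
              zero_less_one t(1) mx' t(4-6) gap'])
      then show "\<mu> * - u b - ?\<Lambda> * (t * - \<Psi>\<^sub>m a) \<le> - (?\<kappa> R \<rho> * m)"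
        by (simp add: algebra_simps)
    qed
    then show "\<mu> < ?\<Lambda> \<or> (\<mu> = ?\<Lambda> \<and> (\<exists>t>0. \<forall>x. u x = t * \<Psi>\<^sub>m x))"
      by (cases "\<mu> < ?\<Lambda>") auto
  }
qed

end
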